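(* Suppose that $\alpha>1$, that there exists $\varepsilon\in(0,\alpha-1)$ such that $(\alpha-3)w(t) - t\dot w(t)\ge\varepsilon b(t)$ for every $t\ge t_0$, that $\lambda$ and $\beta$ are nondecreasing on $[t_0,+\infty)$, and that $b(t)>\dot\beta(t)+\frac{\beta(t)}{t}$ for every $t\ge t_0$. Assume in addition that $$\int_{t_0}^{+\infty}\left[\frac{(\dot\lambda(t))^2t^3\beta^2(t)}{\lambda^4(t)} - \frac{\dot\lambda(t)t^2b(t)}{2\lambda^2(t)}\right]_+dt < +\infty,$$ where $[\cdot]_+$ denotes the positive part, and that there exists $C>0$ such that $$\frac{d}{dt}\big(t^2b(t)\big)\le C\,t\,b(t)\quad\text{for every } t\ge t_0 .$$ Let $x:[t_0,+\infty)\to H$ be a solution of $$\ddot x(t) + \frac{\alpha}{t}\dot x(t) + \beta(t)\frac{d}{dt}\nabla\Phi_{\lambda(t)}(x(t)) + b(t)\nabla\Phi_{\lambda(t)}(x(t)) = 0 .$$ Then, as $t\to+\infty$, $$\Phi_{\lambda(t)}(x(t)) - \Phi^* = o\left(\frac{1}{t^2b(t)}\right),\qquad \|\dot x(t)\| = o\left(\frac1t\right).$$ Moreover, as $t\to+\infty$, $$\|\nabla\Phi_{\lambda(t)}(x(t))\| = o\left(\frac{1}{t\sqrt{b(t)\lambda(t)}}\right),$$ $$\Phi\big(\operatorname{prox}_{\lambda(t)\Phi}(x(t))\big) - \Phi^* = o\left(\frac{1}{t^2b(t)}\right),\qquad \|\operatorname{prox}_{\lambda(t)\Phi}(x(t))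 - x(t)\| = o\left(\frac{\sqrt{\lambda(t)}}{t\sqrt{b(t)}}\right).$$
   Context: $H$ is a real Hilbert space with scalar product $\langle\cdot,\cdot\rangle$ and norm $\|\cdot\|$. $\Phi:H\to\mathbb{R}\cup\{\pm\infty\}$ is proper, convex and lower semicontinuous; its set of global minimizers $\operatorname{argmin}\Phi$ is nonempty, and $\Phi^*$ denotes its minimal value. For $\mu>0$, the Moreau envelope is $\Phi_\mu(x) = \inf_{y\in H}\{\Phi(y) + \frac{1}{2\mu}\|x-y\|^2\}$, which is a convex, continuously differentiable real-valued function on $H$ with gradient $\nabla\Phi_\mu$, and the proximal operator is $\operatorname{prox}_{\mu\Phi}(x) = \operatorname{argmin}_{y\in H}\{\Phi(y)+\frac{1}{2\mu}\|x-y\|^2\}$ (the unique minimizer). $t_0>0$; $\beta:[t_0,+\infty)\to[0,+\infty)$ and $b,\lambda:[t_0,+\infty)\to(0,+\infty)$ are differentiable, and $\beta$ is twice differentiable. The function $w:[t_0,+\infty)\to\mathbb{R}$ is $w(t) = b(t) - \dot\beta(t) - \frac{\beta(t)}{t}$. A solution is a continuously differentiable $x:[t_0,+\infty)\to H$ such that $\dot x$ and $t\mapsto\nabla\Phi_{\lambda(t)}(x(t))$ are locally absolutely continuous and the evolution equation holds for almost every $t\ge t_0$ (with some initial data $x(t_0)=x_0\in H$, $\dot x(t_0)=u_0\in H$). *)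

theory Defs
  imports "HOL-Analysis.Analysis" "HOL-Library.Landau_Symbols"
begin

definition proper_fun :: "('a \<Rightarrow> ereal) \<Rightarrow> bool" where
  "proper_fun \<Phi> \<longleftrightarrow> (\<forall>x. \<Phi> x \<noteq> -\<infinity>) \<and> (\<exists>x. \<Phi> x \<noteq> \<infinity>)"

text \<open>The weights are strictly positive, so for a proper function no undefined expression
  (such as \<open>0 * \<infinity>\<close> or \<open>\<infinity> - \<infinity>\<close>) occurs in the inequality.\<close>

definition convex_fun :: "('a::real_vector \<Rightarrow> ereal) \<Rightarrow> bool" where
  "convex_fun \<Phi> \<longleftrightarrow> (\<forall>x y. \<forall>u\<in>{0<..<1}.
     \<Phi> (u *\<^sub>R x + (1 - u) *\<^sub>R y) \<le> ereal u * \<Phi> x + ereal (1 - u) * \<Phi> y)"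

definition lower_semicontinuous :: "('a::topological_space \<Rightarrow> ereal) \<Rightarrow> bool" where
  "lower_semicontinuous \<Phi> \<longleftrightarrow> (\<forall>x. \<Phi> x \<le> Liminf (at x) \<Phi>)"

definition argmin :: "('a \<Rightarrow> ereal) \<Rightarrow> 'a set" where
  "argmin \<Phi> = {x. is_arg_min \<Phi> (\<lambda>_. True) x}"

definition min_value :: "('a \<Rightarrow> ereal) \<Rightarrow> ereal" where
  "min_value \<Phi> = (INF x. \<Phi> x)"

definition prox_objective :: "real \<Rightarrow> ('a::real_normed_vector \<Rightarrow> ereal) \<Rightarrow> 'a \<Rightarrow> 'a \<Rightarrow> ereal" where
  "prox_objective \<mu> \<Phi> x y = \<Phi> y + ereal (1 / (2 * \<mu>) * (norm (x - y))\<^sup>2)"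

text \<open>For \<open>\<mu> > 0\<close> and \<open>\<Phi>\<close> proper, convex and lower semicontinuous on a Hilbert space, the
  infimum defining the Moreau envelope is finite and is attained at exactly one point. Hence
  \<open>real_of_ereal\<close> and the choice in \<open>arg_min\<close> below lose nothing, and \<open>\<Phi> (prox \<mu> \<Phi> x)\<close> is finite.\<close>

definition moreau_envelope :: "real \<Rightarrow> ('a::real_normed_vector \<Rightarrow> ereal) \<Rightarrow> 'a \<Rightarrow> real" where
  "moreau_envelope \<mu> \<Phi> x = real_of_ereal (INF y. prox_objective \<mu> \<Phi> x y)"

definition prox :: "real \<Rightarrow> ('a::real_normed_vector \<Rightarrow> ereal) \<Rightarrow> 'a \<Rightarrow> 'a" where
  "prox \<mu> \<Phi> x = arg_min (prox_objective \<mu> \<Phi> x) (\<lambda>_. True)"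

definition gradient :: "('a::real_inner \<Rightarrow> real) \<Rightarrow> 'a \<Rightarrow> 'a" where
  "gradient f x = (THE D. GDERIV f x :> D)"

text \<open>Only the values on \<open>[t\<^sub>0,+\<infinity>)\<close> matter: this is the ordinary derivative at \<open>t > t\<^sub>0\<close>
  and the right derivative at \<open>t\<^sub>0\<close>.\<close>

definition dot :: "real \<Rightarrow> (real \<Rightarrow> 'a::real_normed_vector) \<Rightarrow> real \<Rightarrow> 'a" where
  "dot t0 f t = vector_derivative f (at t within {t0..})"

definition absolutely_continuous_on_interval ::
    "real \<Rightarrow> real \<Rightarrow> (real \<Rightarrow> 'a::real_normed_vector) \<Rightarrow> bool" where
  "absolutely_continuous_on_interval a b f \<longleftrightarrow>
     (\<forall>\<epsilon>>0. \<exists>\<delta>>0. \<forall>(n::nat) u v.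
        (\<forall>i<n. a \<le> u i \<and> u i \<le> v i \<and> v i \<le> b) \<longrightarrow>
        disjoint_family_on (\<lambda>i. {u i<..<v i}) {..<n} \<longrightarrow>
        (\<Sum>i<n. v i - u i) < \<delta> \<longrightarrow>
        (\<Sum>i<n. norm (f (v i) - f (u i))) < \<epsilon>)"

definition locally_absolutely_continuous ::
    "real \<Rightarrow> (real \<Rightarrow> 'a::real_normed_vector) \<Rightarrow> bool" where
  "locally_absolutely_continuous t0 f \<longleftrightarrow>
     (\<forall>a b. t0 \<le> a \<longrightarrow> a \<le> b \<longrightarrow> absolutely_continuous_on_interval a b f)"

definition moreau_gradient_along ::
    "('a::real_inner \<Rightarrow> ereal) \<Rightarrow> (real \<Rightarrow> real) \<Rightarrow> (real \<Rightarrow> 'a) \<Rightarrow> real \<Rightarrow> 'a" where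
  "moreau_gradient_along \<Phi> lam x t = gradient (moreau_envelope (lam t) \<Phi>) (x t)"

text \<open>Since \<open>vector_derivative\<close> is total, differentiability at almost every time is spelled out
  as part of the equation being satisfied.\<close>

definition is_solution ::
    "('a::real_inner \<Rightarrow> ereal) \<Rightarrow> real \<Rightarrow> real \<Rightarrow> (real \<Rightarrow> real) \<Rightarrow> (real \<Rightarrow> real) \<Rightarrow> (real \<Rightarrow> real) \<Rightarrow>
     (real \<Rightarrow> 'a) \<Rightarrow> bool" where
  "is_solution \<Phi> \<alpha> t0 \<beta> b lam x \<longleftrightarrow>
     x differentiable_on {t0..} \<and>
     continuous_on {t0..} (dot t0 x) \<and>
     locally_absolutely_continuous t0 (dot t0 x) \<and>
     locally_absolutely_continuous t0 (moreau_gradient_along \<Phi> lam x) \<and>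
     (AE t in lborel. t \<ge> t0 \<longrightarrow>
        dot t0 x differentiable (at t within {t0..}) \<and>
        moreau_gradient_along \<Phi> lam x differentiable (at t within {t0..}) \<and>
        dot t0 (dot t0 x) t + (\<alpha> / t) *\<^sub>R dot t0 x t
          + \<beta> t *\<^sub>R dot t0 (moreau_gradient_along \<Phi> lam x) t
          + b t *\<^sub>R moreau_gradient_along \<Phi> lam x t = 0)"

definition w_fun :: "real \<Rightarrow> (real \<Rightarrow> real) \<Rightarrow> (real \<Rightarrow> real) \<Rightarrow> real \<Rightarrow> real" where
  "w_fun t0 \<beta> b t = b t - dot t0 \<beta> t - \<beta> t / t"

end

theory Submission
  imports Defs
begin

text \<open>The proof is a Lyapunov argument. Write $g(t) = \nabla\Phi_{\lambda(t)}(x(t))$, $v = \dot x$,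
$f(t) = \Phi_{\lambda(t)}(x(t)) - \Phi^*$ and $\gamma = \varepsilon/2$, and let $z$ minimize
$\Phi$. The anchored velocity $V = (\alpha - 1 - \gamma)(x - z) + t(v + \beta g)$ is
chosen because the equation turns $\dot V$ into $-\gamma v - t w g$, in which neither $\ddot x$ nor $\dot g$
occurs. In the derivative of
\[ E = (t^2 w + \gamma t \beta) f + \tfrac12 \|V\|^2 + \tfrac{(\alpha - 1 - \gamma)\gamma}{2} \|x - z\|^2 \]
the products $\langle g, v\rangle$ and $\langle x - z, v\rangle$ cancel; convexity bounds $\langle g, x - z\rangle$ below by $f$,
and the growth hypothesis on $w$ leaves $\dot E \le -\gamma q$, where $q = t b f + t \|v\|^2$
(\<open>lyapunov_derivative_le\<close>). Hence $q$ is integrable and $x$ is bounded.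

The total energy $W = t^2 b f + \tfrac12 t^2 \|v\|^2$ satisfies $W \le t q$, so it cannot stay
away from zero, since $1/t$ is not integrable. It may increase, but only by an integrable amount:
its derivative contains $-t^2 \beta \langle v, \dot g\rangle$, and monotonicity of the gradients
together with their Lipschitz dependence on $\lambda$ gives
$\langle v, \dot g\rangle \ge -(\dot\lambda/\lambda) \|v\| \|g\|$. As $\lambda\|g\| \le \|x - z\|$ is bounded,
Young's inequality reduces the error to a multiple of $q$ plus a multiple of the integrand assumed to be integrable
(\<open>total_energy_derivative_le\<close>). Therefore $W \to 0$ (\<open>dissipation_tendsto_zero\<close>), which contains the first two
rates; the other three follow from
$f = \Phi(\mathrm{prox}) - \Phi^* + \tfrac{\lambda}{2} \|g\|^2$ and $x - \mathrm{prox} = \lambda g$.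

Integrating these almost everywhere inequalities needs care. The energies mix locally absolutely
continuous factors ($v$ and $g$) with coefficients that are assumed differentiable at every point instead. Both kinds of function satisfy the
strong Lusin condition, which is stable under sums and products and suffices for the fundamental
theorem of calculus for the gauge integral (\<open>fundamental_theorem_strong_lusin\<close>).\<close>

section \<open>The strong Lusin condition and the fundamental theorem of calculus\<close>

text \<open>The strong Lusin condition: over tags in a null set, the increments of \<open>F\<close> can be made negligible
by a sufficiently fine gauge. In gauge integration theory it characterizes, together with
differentiability almost everywhere, the indefinite integrals.\<close>

definition strong_lusin :: "real \<Rightarrow> real \<Rightarrow> (real \<Rightarrow> 'a::real_normed_vector) \<Rightarrow> bool" where
  "strong_lusin a b F \<longleftrightarrow>
     (\<forall>N e. negligible N \<longrightarrow> 0 < e \<longrightarrow>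
        (\<exists>\<gamma>. gauge \<gamma> \<and>
           (\<forall>\<D>. \<D> tagged_partial_division_of {a..b} \<longrightarrow> \<gamma> fine \<D> \<longrightarrow> fst ` \<D> \<subseteq> N \<longrightarrow>
              (\<Sum>(x, K)\<in>\<D>. norm (F (Sup K) - F (Inf K))) < e)))"

lemma strong_lusinE:
  assumes "strong_lusin a b F" "negligible N" "0 < e"
  obtains \<gamma> where "gauge \<gamma>"
    "\<And>\<D>. \<D> tagged_partial_division_of {a..b} \<Longrightarrow> \<gamma> fine \<D> \<Longrightarrow> fst ` \<D> \<subseteq> N \<Longrightarrow>
       (\<Sum>(x, K)\<in>\<D>. norm (F (Sup K) - F (Inf K))) < e"
  using assms(1)[unfolded strong_lusin_def, rule_format, OF assms(2,3)] by (elim exE conjE) simp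

lemma tagged_partial_division_real_interval:
  fixes a b :: real
  assumes "\<D> tagged_partial_division_of {a..b}" "(x, K) \<in> \<D>"
  obtains u v where "K = {u..v}" "Sup K = v" "Inf K = u" "a \<le> u" "u \<le> x" "x \<le> v" "v \<le> b"
proof -
  have xK: "x \<in> K" and KI: "K \<subseteq> {a..b}" and "\<exists>u v. K = cbox u v"
    using tagged_partial_division_ofD(2-4)[OF assms] by auto
  then obtain u v where K: "K = {u..v}" by auto
  with xK KI have "u \<le> x" "x \<le> v" "a \<le> u" "v \<le> b" by auto
  with K show thesis by (intro that[of u v]) auto
qed

text \<open>A null set is covered by an open set of measure below the \<open>\<delta>\<close> of absolute continuity. A gauge that
confines every interval tagged in the null set to that cover keeps their total length below \<open>\<delta>\<close>.\<close>

lemma absolutely_continuous_imp_strong_lusin: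
  assumes ac: "absolutely_continuous_on_interval a b F"
  shows "strong_lusin a b F"
  unfolding strong_lusin_def
proof (intro allI impI)
  fix N :: "real set" and e :: real
  assume N: "negligible N" and "e > 0"
  from ac[unfolded absolutely_continuous_on_interval_def, rule_format, OF \<open>e > 0\<close>]
  obtain d where "d > 0" and d: "\<And>(n::nat) u v.
        (\<forall>i<n. a \<le> u i \<and> u i \<le> v i \<and> v i \<le> b) \<Longrightarrow>
        disjoint_family_on (\<lambda>i. {u i<..<v i}) {..<n} \<Longrightarrow>
        (\<Sum>i<n. v i - u i) < d \<Longrightarrow>
        (\<Sum>i<n. norm (F (v i) - F (u i))) < e" by blast
  have NL: "N \<in> sets lebesgue" using N by (simp add: negligible_imp_sets)
  obtain T where T: "open T" "N \<subseteq> T" "T - N \<in> lmeasurable" "emeasure lebesgue (T - N) < ennreal d"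
    using sets_lebesgue_outer_open[OF NL \<open>d > 0\<close>] by blast
  have nullN: "N \<in> null_sets lebesgue" using N by (simp add: negligible_iff_null_sets)
  have eT: "emeasure lebesgue T < ennreal d"
    using T(4) emeasure_Diff_null_set[OF nullN, of T] T(1) by simp
  have TL: "T \<in> lmeasurable"
    using eT T(1) by (intro fmeasurableI) (auto simp: top.not_eq_extremum less_trans[OF _ ennreal_less_top])
  have mT: "measure lebesgue T < d"
    using eT \<open>d > 0\<close> TL by (simp add: emeasure_eq_measure2 ennreal_less_iff)
  define \<gamma> where "\<gamma> x = (if x \<in> T then T else UNIV)" for x :: real
  have "gauge \<gamma>" using T(1) by (auto simp: gauge_def \<gamma>_def)
  moreover have "(\<Sum>(x, K)\<in>\<D>. norm (F (Sup K) - F (Inf K))) < e"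
    if D: "\<D> tagged_partial_division_of {a..b}" and fine: "\<gamma> fine \<D>" and tags: "fst ` \<D> \<subseteq> N" for \<D>
  proof -
    have fin: "finite \<D>" using D by (rule tagged_partial_division_ofD)
    define n where "n = card \<D>"
    obtain h where h: "bij_betw h {..<n} \<D>"
      using ex_bij_betw_nat_finite[OF fin] by (auto simp: n_def atLeast0LessThan)
    define u v where "u i = Inf (snd (h i))" and "v i = Sup (snd (h i))" for i
    have hD: "h i \<in> \<D>" if "i < n" for i using h that by (auto simp: bij_betw_def)
    have I: "snd (h i) = {u i..v i} \<and> a \<le> u i \<and> u i \<le> v i \<and> v i \<le> b \<and> {u i..v i} \<subseteq> T"
      if "i < n" for i
    proof -
      obtain x K where hi: "h i = (x, K)" by force
      then have xK: "(x, K) \<in> \<D>" using hD[OF that] by simp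
      obtain u' v' where K: "K = {u'..v'}" "Sup K = v'" "Inf K = u'" "a \<le> u'" "u' \<le> x" "x \<le> v'" "v' \<le> b"
        using tagged_partial_division_real_interval[OF D xK] by blast
      have "x \<in> N" using tags xK by force
      then have "\<gamma> x = T" using T(2) by (auto simp: \<gamma>_def)
      then have "K \<subseteq> T" using fineD[OF fine xK] by simp
      with K hi show ?thesis by (auto simp: u_def v_def)
    qed
    have disj: "disjoint_family_on (\<lambda>i. {u i<..<v i}) {..<n}"
      unfolding disjoint_family_on_def
    proof (intro ballI impI)
      fix i j assume ij: "i \<in> {..<n}" "j \<in> {..<n}" "i \<noteq> j"
      then have "h i \<noteq> h j" using h by (auto simp: bij_betw_def inj_on_def)
      then have "interior (snd (h i)) \<inter> interior (snd (h j)) = {}"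
        using tagged_partial_division_ofD(5)[OF D, of "fst (h i)" "snd (h i)" "fst (h j)" "snd (h j)"]
          hD ij by auto
      then show "{u i<..<v i} \<inter> {u j<..<v j} = {}" using I ij by simp
    qed
    have "(\<Sum>i<n. v i - u i) = (\<Sum>i<n. measure lebesgue {u i<..<v i})"
      using I by (intro sum.cong) auto
    also have "\<dots> = measure lebesgue (\<Union>i<n. {u i<..<v i})"
      by (rule measure_finite_Union[symmetric]) (use disj I in \<open>auto simp: less_imp_le\<close>)
    also have "\<dots> \<le> measure lebesgue T"
      by (rule measure_mono_fmeasurable[OF _ _ TL]) (use I in \<open>fastforce+\<close>)
    finally have "(\<Sum>i<n. norm (F (v i) - F (u i))) < e"
      using mT I disj by (intro d) auto
    moreover have "(\<Sum>(x, K)\<in>\<D>. norm (F (Sup K) - F (Inf K))) = (\<Sum>i<n. norm (F (v i) - F (u i)))"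
      using sum.reindex_bij_betw[OF h, of "\<lambda>(x, K). norm (F (Sup K) - F (Inf K))"]
      by (simp add: u_def v_def case_prod_unfold)
    ultimately show ?thesis by simp
  qed
  ultimately show "\<exists>\<gamma>. gauge \<gamma> \<and>
           (\<forall>\<D>. \<D> tagged_partial_division_of {a..b} \<longrightarrow> \<gamma> fine \<D> \<longrightarrow> fst ` \<D> \<subseteq> N \<longrightarrow>
              (\<Sum>(x, K)\<in>\<D>. norm (F (Sup K) - F (Inf K))) < e)" by blast
qed

text \<open>The straddle lemma: comparing the values at both ends with the value at the tag makes the error proportional to
the length of the interval.\<close>

lemma vector_derivative_straddle:
  assumes der: "(F has_vector_derivative D) (at x within {a..b})" and "x \<in> {a..b}" "e > 0"
  shows "\<exists>d>0. \<forall>u v. a \<le> u \<and> u \<le> x \<and> x \<le> v \<and> v \<le> b \<and> {u..v} \<subseteq> ball x d \<longrightarrow>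
       norm (F v - F u - (v - u) *\<^sub>R D) \<le> e * (v - u)"
proof -
  from der[unfolded has_vector_derivative_def has_derivative_within_alt] \<open>e > 0\<close>
  obtain d where "d > 0" and d: "\<And>y. y \<in> {a..b} \<Longrightarrow> norm (y - x) < d \<Longrightarrow>
      norm (F y - F x - (y - x) *\<^sub>R D) \<le> e * norm (y - x)" by blast
  show ?thesis
  proof (intro exI[of _ d] conjI allI impI \<open>d > 0\<close>; elim conjE)
    fix u v assume uv: "a \<le> u" "u \<le> x" "x \<le> v" "v \<le> b" "{u..v} \<subseteq> ball x d"
    then have "u \<in> {u..v}" "v \<in> {u..v}" by auto
    with uv have "u \<in> ball x d" "v \<in> ball x d" by blast+
    then have "norm (F u - F x - (u - x) *\<^sub>R D) \<le> e * (x - u)"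
      and "norm (F v - F x - (v - x) *\<^sub>R D) \<le> e * (v - x)"
      using d[of u] d[of v] uv by (auto simp: dist_real_def)
    moreover have "F v - F u - (v - u) *\<^sub>R D
        = (F v - F x - (v - x) *\<^sub>R D) - (F u - F x - (u - x) *\<^sub>R D)"
      by (simp add: algebra_simps)
    ultimately show "norm (F v - F u - (v - u) *\<^sub>R D) \<le> e * (v - u)"
      using norm_triangle_ineq4[of "F v - F x - (v - x) *\<^sub>R D" "F u - F x - (u - x) *\<^sub>R D"]
      by (simp add: algebra_simps)
  qed
qed

text \<open>Near a tag \<open>x\<close> the increments are at most \<open>norm (F' x) + 1\<close> times the length of the interval. Cutting this
function off outside the null set gives a function with integral zero, however
irregular \<open>F'\<close> is, so that Henstock's lemma controls the sums.\<close>

lemma differentiable_imp_strong_lusin: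
  assumes der: "\<And>x. x \<in> {a..b} \<Longrightarrow> (F has_vector_derivative F' x) (at x within {a..b})"
  shows "strong_lusin a b F"
  unfolding strong_lusin_def
proof (intro allI impI)
  fix N :: "real set" and e :: real
  assume N: "negligible N" and "e > 0"
  define h where "h x = (if x \<in> N then norm (F' x) + 1 else 0)" for x
  have hI: "(h has_integral 0) S" for S
    by (rule has_integral_negligible[OF N]) (auto simp: h_def)
  then have hint: "h integrable_on cbox a b" by blast
  obtain \<gamma>1 where g1: "gauge \<gamma>1" "\<And>p. p tagged_partial_division_of (cbox a b) \<Longrightarrow> \<gamma>1 fine p \<Longrightarrow>
             (\<Sum>(x,k)\<in>p. norm (measure lborel k *\<^sub>R h x - integral k h)) < e"
    by (rule Henstock_lemma[OF hint \<open>e > 0\<close>]) blast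
  define good where "good x d \<longleftrightarrow> d > 0 \<and> (\<forall>u v. a \<le> u \<and> u \<le> x \<and> x \<le> v \<and> v \<le> b \<and> {u..v} \<subseteq> ball x d \<longrightarrow>
       norm (F v - F u - (v - u) *\<^sub>R F' x) \<le> 1 * (v - u))" for x d
  define d where "d x = (if x \<in> {a..b} then SOME d. good x d else 1)" for x
  have good: "good x (d x)" if "x \<in> {a..b}" for x
    using someI_ex[of "good x"] vector_derivative_straddle[OF der[OF that] that zero_less_one] that
    unfolding good_def d_def by simp
  then have d: "d x > 0" for x by (cases "x \<in> {a..b}") (auto simp: good_def d_def)
  define \<gamma> where "\<gamma> x = \<gamma>1 x \<inter> ball x (d x)" for x
  have "gauge \<gamma>" unfolding \<gamma>_def using g1(1) d by (auto simp: gauge_def)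
  moreover have "(\<Sum>(x, K)\<in>\<D>. norm (F (Sup K) - F (Inf K))) < e"
    if D: "\<D> tagged_partial_division_of {a..b}" and fine: "\<gamma> fine \<D>" and tags: "fst ` \<D> \<subseteq> N" for \<D>
  proof -
    have "(\<Sum>(x, K)\<in>\<D>. norm (F (Sup K) - F (Inf K)))
        \<le> (\<Sum>(x,k)\<in>\<D>. norm (measure lborel k *\<^sub>R h x - integral k h))"
    proof (rule sum_mono, clarify)
      fix x K assume xK: "(x, K) \<in> \<D>"
      obtain u v where K: "K = {u..v}" "Sup K = v" "Inf K = u" "a \<le> u" "u \<le> x" "x \<le> v" "v \<le> b"
        using tagged_partial_division_real_interval[OF D xK] by blast
      have "x \<in> N" using tags xK by force
      have "{u..v} \<subseteq> ball x (d x)" using fine xK K(1) by (auto simp: fine_def \<gamma>_def)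
      then have "norm (F v - F u - (v - u) *\<^sub>R F' x) \<le> v - u"
        using good[of x] K by (simp add: good_def)
      then have "norm (F v - F u) \<le> (v - u) * (norm (F' x) + 1)"
        using norm_triangle_sub[of "F v - F u" "(v - u) *\<^sub>R F' x"] K
        by (simp add: distrib_left)
      also have "\<dots> = norm (measure lborel K *\<^sub>R h x - integral K h)"
        using K \<open>x \<in> N\<close> integral_unique[OF hI[of K]] by (simp add: h_def)
      finally show "norm (F (Sup K) - F (Inf K)) \<le> norm (measure lborel K *\<^sub>R h x - integral K h)"
        using K by simp
    qed
    also have "\<dots> < e" using g1(2)[of \<D>] D fine by (auto simp: fine_def \<gamma>_def)
    finally show ?thesis .
  qed
  ultimately show "\<exists>\<gamma>. gauge \<gamma> \<and>
           (\<forall>\<D>. \<D> tagged_partial_division_of {a..b} \<longrightarrow> \<gamma> fine \<D> \<longrightarrow> fst ` \<D> \<subseteq> N \<longrightarrow>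
              (\<Sum>(x, K)\<in>\<D>. norm (F (Sup K) - F (Inf K))) < e)" by blast
qed

text \<open>A single point is a null set, and a one-element division tagged there measures the oscillation at this point.\<close>

lemma strong_lusin_imp_continuous_on:
  assumes "strong_lusin a b F"
  shows "continuous_on {a..b} F"
  unfolding continuous_on_iff
proof (intro ballI allI impI)
  fix t e :: real assume t: "t \<in> {a..b}" and "e > 0"
  have "negligible {t}" by simp
  obtain \<gamma> where \<gamma>: "gauge \<gamma>" "\<And>\<D>. \<D> tagged_partial_division_of {a..b} \<Longrightarrow> \<gamma> fine \<D> \<Longrightarrow> fst ` \<D> \<subseteq> {t} \<Longrightarrow>
       (\<Sum>(x, K)\<in>\<D>. norm (F (Sup K) - F (Inf K))) < e"
    by (rule strong_lusinE[OF assms \<open>negligible {t}\<close> \<open>e > 0\<close>]) blast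
  obtain d where d: "d > 0" "ball t d \<subseteq> \<gamma> t"
    using \<gamma>(1) open_contains_ball unfolding gauge_def by blast
  show "\<exists>d>0. \<forall>s\<in>{a..b}. dist s t < d \<longrightarrow> dist (F s) (F t) < e"
  proof (intro exI conjI ballI impI)
    fix s assume s: "s \<in> {a..b}" "dist s t < d"
    let ?D = "{(t, {min s t..max s t})}"
    have "?D tagged_partial_division_of {a..b}"
      using s t by (auto simp: tagged_partial_division_of_def)
    moreover have "{min s t..max s t} \<subseteq> ball t d"
      using s(2) by (auto simp: dist_real_def)
    then have "\<gamma> fine ?D" using d(2) by (auto simp: fine_def)
    ultimately have "(\<Sum>(x, K)\<in>?D. norm (F (Sup K) - F (Inf K))) < e" by (rule \<gamma>(2)) simp
    then show "dist (F s) (F t) < e"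
      by (cases "s \<le> t") (auto simp: dist_norm norm_minus_commute min_def max_def)
  qed (rule d(1))
qed

lemma strong_lusin_dominated:
  assumes F: "strong_lusin a b F" and G: "strong_lusin a b G"
    and dom: "\<And>u v. a \<le> u \<Longrightarrow> u \<le> v \<Longrightarrow> v \<le> b \<Longrightarrow>
       norm (H v - H u) \<le> c * (norm (F v - F u) + norm (G v - G u))"
  shows "strong_lusin a b H"
  unfolding strong_lusin_def
proof (intro allI impI)
  fix N :: "real set" and e :: real
  assume N: "negligible N" and "e > 0"
  define k where "k = \<bar>c\<bar> + 1"
  have k: "k > 0" "c \<le> k" by (auto simp: k_def)
  have ek: "e / (2 * k) > 0" using k \<open>e > 0\<close> by simp
  obtain \<gamma>1 where g1: "gauge \<gamma>1" "\<And>\<D>. \<D> tagged_partial_division_of {a..b} \<Longrightarrow> \<gamma>1 fine \<D> \<Longrightarrow> fst ` \<D> \<subseteq> N \<Longrightarrow>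
              (\<Sum>(x, K)\<in>\<D>. norm (F (Sup K) - F (Inf K))) < e / (2 * k)"
    by (rule strong_lusinE[OF F N ek]) blast
  obtain \<gamma>2 where g2: "gauge \<gamma>2" "\<And>\<D>. \<D> tagged_partial_division_of {a..b} \<Longrightarrow> \<gamma>2 fine \<D> \<Longrightarrow> fst ` \<D> \<subseteq> N \<Longrightarrow>
              (\<Sum>(x, K)\<in>\<D>. norm (G (Sup K) - G (Inf K))) < e / (2 * k)"
    by (rule strong_lusinE[OF G N ek]) blast
  have "gauge (\<lambda>x. \<gamma>1 x \<inter> \<gamma>2 x)" using g1(1) g2(1) by (rule gauge_Int)
  moreover have "(\<Sum>(x, K)\<in>\<D>. norm (H (Sup K) - H (Inf K))) < e"
    if D: "\<D> tagged_partial_division_of {a..b}" and fine: "(\<lambda>x. \<gamma>1 x \<inter> \<gamma>2 x) fine \<D>" and tags: "fst ` \<D> \<subseteq> N" for \<D>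
  proof -
    have "(\<Sum>(x, K)\<in>\<D>. norm (H (Sup K) - H (Inf K)))
        \<le> (\<Sum>(x, K)\<in>\<D>. k * (norm (F (Sup K) - F (Inf K)) + norm (G (Sup K) - G (Inf K))))"
    proof (rule sum_mono, clarify)
      fix x K assume xK: "(x, K) \<in> \<D>"
      obtain u v where K: "K = {u..v}" "Sup K = v" "Inf K = u" "a \<le> u" "u \<le> x" "x \<le> v" "v \<le> b"
        using tagged_partial_division_real_interval[OF D xK] by blast
      have "norm (H v - H u) \<le> c * (norm (F v - F u) + norm (G v - G u))" using dom K by simp
      also have "\<dots> \<le> k * (norm (F v - F u) + norm (G v - G u))"
        using k by (intro mult_right_mono) auto
      finally show "norm (H (Sup K) - H (Inf K))
          \<le> k * (norm (F (Sup K) - F (Inf K)) + norm (G (Sup K) - G (Inf K)))" using K by simp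
    qed
    also have "\<dots> = k * ((\<Sum>(x, K)\<in>\<D>. norm (F (Sup K) - F (Inf K))) + (\<Sum>(x, K)\<in>\<D>. norm (G (Sup K) - G (Inf K))))"
      by (simp add: case_prod_unfold sum_distrib_left sum.distrib distrib_left)
    also have "\<dots> < k * (e / (2 * k) + e / (2 * k))"
      using g1(2)[OF D _ tags] g2(2)[OF D _ tags] fine k
      by (intro mult_strict_left_mono add_strict_mono) (simp_all only: fine_Int)
    also have "\<dots> = e" using k by (simp add: field_simps)
    finally show ?thesis .
  qed
  ultimately show "\<exists>\<gamma>. gauge \<gamma> \<and>
           (\<forall>\<D>. \<D> tagged_partial_division_of {a..b} \<longrightarrow> \<gamma> fine \<D> \<longrightarrow> fst ` \<D> \<subseteq> N \<longrightarrow>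
              (\<Sum>(x, K)\<in>\<D>. norm (H (Sup K) - H (Inf K))) < e)" by blast
qed

lemma strong_lusin_add:
  assumes "strong_lusin a b F" "strong_lusin a b G"
  shows "strong_lusin a b (\<lambda>t. F t + G t)"
proof (rule strong_lusin_dominated[OF assms, of _ 1])
  fix u v
  show "norm (F v + G v - (F u + G u)) \<le> 1 * (norm (F v - F u) + norm (G v - G u))"
    using norm_triangle_ineq[of "F v - F u" "G v - G u"] by (simp add: algebra_simps)
qed

text \<open>The product rule for differences applies, because both factors are bounded on the compact interval.\<close>

lemma strong_lusin_bilinear:
  assumes bl: "bounded_bilinear mul"
    and F: "strong_lusin a b F" and G: "strong_lusin a b G"
  shows "strong_lusin a b (\<lambda>t. mul (F t) (G t))"
proof -
  interpret bounded_bilinear mul by (rule bl)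
  have "bounded (F ` {a..b} )" "bounded (G ` {a..b})"
    using F[THEN strong_lusin_imp_continuous_on] G[THEN strong_lusin_imp_continuous_on] by (auto intro!: compact_imp_bounded compact_continuous_image)
  then obtain A B where A: "\<And>t. t \<in> {a..b} \<Longrightarrow> norm (F t) \<le> A" and B: "\<And>t. t \<in> {a..b} \<Longrightarrow> norm (G t) \<le> B"
    unfolding bounded_iff by blast
  obtain k where k: "k \<ge> 0" "\<And>x y. norm (mul x y) \<le> norm x * norm y * k"
    using nonneg_bounded by blast
  show ?thesis
  proof (rule strong_lusin_dominated[OF F G, of _ "k * max A B"])
    fix u v :: real assume uv: "a \<le> u" "u \<le> v" "v \<le> b"
    have "mul (F v) (G v) - mul (F u) (G u) = mul (F v - F u) (G v) + mul (F u) (G v - G u)"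
      by (simp add: diff_left diff_right)
    also have "norm \<dots> \<le> norm (F v - F u) * norm (G v) * k + norm (F u) * norm (G v - G u) * k"
      by (rule order_trans[OF norm_triangle_ineq add_mono[OF k(2) k(2)]])
    also have "\<dots> \<le> norm (F v - F u) * max A B * k + max A B * norm (G v - G u) * k"
      using A[of u] B[of v] uv k(1) by (intro add_mono mult_right_mono mult_left_mono) auto
    finally show "norm (mul (F v) (G v) - mul (F u) (G u)) \<le> k * max A B * (norm (F v - F u) + norm (G v - G u))"
      by (simp add: algebra_simps)
  qed
qed

text \<open>The sum over a fine division splits according to whether the tag lies in the exceptional set. The strong Lusin
condition handles the tags inside, the straddle lemma those outside.\<close>

lemma fundamental_theorem_strong_lusin:
  fixes F :: "real \<Rightarrow> 'a::banach"
  assumes "a \<le> b" and SL: "strong_lusin a b F" and N: "negligible N"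
    and der: "\<And>x. x \<in> {a..b} - N \<Longrightarrow> (F has_vector_derivative f x) (at x within {a..b})"
  shows "(f has_integral (F b - F a)) {a..b}"
proof -
  define g where "g x = (if x \<in> N then 0 else f x)" for x
  have "(g has_integral (F b - F a)) {a..b}"
    unfolding has_integral_real
  proof (intro allI impI)
    fix e :: real assume "e > 0"
    define \<eta> where "\<eta> = e / (2 * (b - a + 1))"
    have \<eta>: "\<eta> > 0" "\<eta> * (b - a) < e / 2"
      using \<open>e > 0\<close> \<open>a \<le> b\<close> by (auto simp: \<eta>_def field_simps)
    have e2: "e / 2 > 0" using \<open>e > 0\<close> by simp
    obtain \<gamma>1 where g1: "gauge \<gamma>1" "\<And>\<D>. \<D> tagged_partial_division_of {a..b} \<Longrightarrow> \<gamma>1 fine \<D> \<Longrightarrow> fst ` \<D> \<subseteq> N \<Longrightarrow>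
              (\<Sum>(x, K)\<in>\<D>. norm (F (Sup K) - F (Inf K))) < e / 2"
      by (rule strong_lusinE[OF SL N e2]) blast
    define good where "good x d \<longleftrightarrow> d > 0 \<and> (\<forall>u v. a \<le> u \<and> u \<le> x \<and> x \<le> v \<and> v \<le> b \<and> {u..v} \<subseteq> ball x d \<longrightarrow>
         norm (F v - F u - (v - u) *\<^sub>R f x) \<le> \<eta> * (v - u))" for x d
    define d where "d x = (if x \<in> {a..b} - N then SOME d. good x d else 1)" for x
    have good: "good x (d x)" if "x \<in> {a..b} - N" for x
      using someI_ex[of "good x"] vector_derivative_straddle[OF der[OF that] _ \<eta>(1)] that
      unfolding good_def d_def by simp
    then have d: "d x > 0" for x by (cases "x \<in> {a..b} - N") (auto simp: good_def d_def)
    define \<gamma> where "\<gamma> x = \<gamma>1 x \<inter> ball x (d x)" for x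
    have gauge: "gauge \<gamma>" unfolding \<gamma>_def using g1(1) d by (auto simp: gauge_def)
    have main: "norm ((\<Sum>(x, K)\<in>\<D>. measure lborel K *\<^sub>R g x) - (F b - F a)) < e"
      if D: "\<D> tagged_division_of {a..b}" and fine: "\<gamma> fine \<D>" for \<D>
    proof -
      have Dp: "\<D> tagged_partial_division_of {a..b}" using D by (simp add: tagged_division_of_def)
      have fin: "finite \<D>" using D by (rule tagged_division_of_finite)
      let ?N = "{p \<in> \<D>. fst p \<in> N}" and ?M = "{p \<in> \<D>. fst p \<notin> N}"
      have split: "\<D> = ?N \<union> ?M" "?N \<inter> ?M = {}" by auto
      let ?r = "\<lambda>(x, K). norm (measure lborel K *\<^sub>R g x - (F (Sup K) - F (Inf K)))"
      have "F b - F a = (\<Sum>(x, K)\<in>\<D>. F (Sup K) - F (Inf K))"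
        using additive_tagged_division_1[OF \<open>a \<le> b\<close> D, of F] by simp
      then have "norm ((\<Sum>(x, K)\<in>\<D>. measure lborel K *\<^sub>R g x) - (F b - F a)) \<le> sum ?r \<D>"
        by (auto simp: sum_subtractf[symmetric] case_prod_unfold intro!: sum_norm_le)
      also have "\<dots> = sum ?r ?N + sum ?r ?M"
        using sum.union_disjoint[of ?N ?M ?r] fin split by simp
      also have "sum ?r ?N = (\<Sum>(x, K)\<in>?N. norm (F (Sup K) - F (Inf K)))"
        by (intro sum.cong) (auto simp: g_def norm_minus_commute)
      also have "\<dots> < e / 2"
      proof (rule g1(2))
        show "?N tagged_partial_division_of {a..b}"
          by (rule tagged_partial_division_subset[OF Dp]) auto
      qed (use fine in \<open>auto simp: fine_def \<gamma>_def\<close>)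
      also have "sum ?r ?M \<le> (\<Sum>(x, K)\<in>?M. \<eta> * (Sup K - Inf K))"
      proof (rule sum_mono, clarsimp)
        fix x K assume xK: "(x, K) \<in> \<D>" and "x \<notin> N"
        obtain u v where K: "K = {u..v}" "Sup K = v" "Inf K = u" "a \<le> u" "u \<le> x" "x \<le> v" "v \<le> b"
          using tagged_partial_division_real_interval[OF Dp xK] by blast
        have "{u..v} \<subseteq> ball x (d x)" using fine xK K(1) by (auto simp: fine_def \<gamma>_def)
        then have "norm (F v - F u - (v - u) *\<^sub>R f x) \<le> \<eta> * (v - u)"
          using good[of x] \<open>x \<notin> N\<close> K by (simp add: good_def)
        then show "norm (measure lborel K *\<^sub>R g x - (F (Sup K) - F (Inf K))) \<le> \<eta> * (Sup K - Inf K)"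
          using K \<open>x \<notin> N\<close> by (simp add: g_def norm_minus_commute)
      qed
      also have "\<dots> \<le> (\<Sum>(x, K)\<in>\<D>. \<eta> * (Sup K - Inf K))"
      proof (rule sum_mono2[OF fin])
        fix p assume "p \<in> \<D> - ?M"
        then obtain x K where p: "p = (x, K)" "(x, K) \<in> \<D>" by (cases p) auto
        obtain u v where "Sup K = v" "Inf K = u" "u \<le> x" "x \<le> v"
          using tagged_partial_division_real_interval[OF Dp p(2)] by blast
        then show "0 \<le> (case p of (x, K) \<Rightarrow> \<eta> * (Sup K - Inf K))"
          using p(1) \<eta>(1) by simp
      qed auto
      also have "\<dots> = \<eta> * (\<Sum>(x, K)\<in>\<D>. Sup K - Inf K)"
        by (simp add: sum_distrib_left case_prod_unfold)
      also have "(\<Sum>(x, K)\<in>\<D>. Sup K - Inf K) = b - a"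
        using additive_tagged_division_1[OF \<open>a \<le> b\<close> D, of "\<lambda>x. x"] by simp
      also have "\<eta> * (b - a) < e / 2" by (rule \<eta>)
      finally show ?thesis by simp
    qed
    show "\<exists>\<gamma>. gauge \<gamma> \<and> (\<forall>\<D>. \<D> tagged_division_of {a..b} \<and> \<gamma> fine \<D> \<longrightarrow>
        norm ((\<Sum>(x, K)\<in>\<D>. measure lborel K *\<^sub>R g x) - (F b - F a)) < e)"
      using gauge main by (intro exI[of _ \<gamma>]) simp
  qed
  then show ?thesis
    by (rule has_integral_spike[OF N, rotated]) (auto simp: g_def)
qed

section \<open>Derivatives on a half line\<close>

lemma has_vector_derivative_iff_difference_quotient:
  "(f has_vector_derivative D) (at t within S)
     \<longleftrightarrow> ((\<lambda>s. (1 / (s - t)) *\<^sub>R (f s - f t)) \<longlongrightarrow> D) (at t within S)"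
proof -
  have eq: "norm ((1 / norm (s - t)) *\<^sub>R (f s - (f t + (s - t) *\<^sub>R D)))
      = norm ((1 / (s - t)) *\<^sub>R (f s - f t) - D)" if "s \<noteq> t" for s
  proof -
    have "(1 / (s - t)) *\<^sub>R (f s - f t) - D = (1 / (s - t)) *\<^sub>R (f s - (f t + (s - t) *\<^sub>R D))"
      using that by (simp add: scaleR_diff_right scaleR_add_right)
    then show ?thesis by simp
  qed
  have "(f has_vector_derivative D) (at t within S)
      \<longleftrightarrow> ((\<lambda>s. (1 / norm (s - t)) *\<^sub>R (f s - (f t + (s - t) *\<^sub>R D))) \<longlongrightarrow> 0) (at t within S)"
    by (simp add: has_vector_derivative_def has_derivative_within bounded_linear_scaleR_left)
  also have "\<dots> \<longleftrightarrow> ((\<lambda>s. norm ((1 / (s - t)) *\<^sub>R (f s - f t) - D)) \<longlongrightarrow> 0) (at t within S)"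
    unfolding tendsto_norm_zero_iff[symmetric, of "\<lambda>s. (1 / norm (s - t)) *\<^sub>R (f s - (f t + (s - t) *\<^sub>R D))"]
    by (rule tendsto_cong) (use eq in \<open>auto simp: eventually_at_filter intro!: always_eventually\<close>)
  also have "\<dots> \<longleftrightarrow> ((\<lambda>s. (1 / (s - t)) *\<^sub>R (f s - f t)) \<longlongrightarrow> D) (at t within S)"
    by (simp only: tendsto_norm_zero_iff LIM_zero_iff)
  finally show ?thesis .
qed

lemmas has_vector_derivative_inner = bounded_bilinear.has_vector_derivative[OF bounded_bilinear_inner]
lemmas has_vector_derivative_real_mult = bounded_bilinear.has_vector_derivative[OF bounded_bilinear_mult]
lemmas has_vector_derivative_real_scaleR = bounded_bilinear.has_vector_derivative[OF bounded_bilinear_scaleR]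

lemma has_vector_derivative_dot:
  assumes "f differentiable_on {t0..}" "t0 \<le> t"
  shows "(f has_vector_derivative dot t0 f t) (at t within {t0..})"
  using assms unfolding dot_def differentiable_on_def by (simp add: vector_derivative_works)

lemma at_within_half_line_nontrivial: "t0 \<le> t \<Longrightarrow> at t within {t0..} \<noteq> bot" for t :: real
proof
  assume "t0 \<le> t" and "at t within {t0..} = bot"
  moreover have "at_right t \<le> at t within {t0..}" using \<open>t0 \<le> t\<close> by (intro at_le) auto
  ultimately have "at_right t = bot" by (simp add: bot_unique)
  then show False using trivial_limit_at_right_real by blast
qed

lemma dot_nonneg_of_mono:
  fixes f :: "real \<Rightarrow> real"
  assumes "mono_on {t0..} f" "f differentiable_on {t0..}" "t0 \<le> t"
  shows "0 \<le> dot t0 f t"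
proof -
  have "((\<lambda>s. (f s - f t) / (s - t)) \<longlongrightarrow> dot t0 f t) (at t within {t0..})"
    using has_vector_derivative_dot[OF assms(2,3)] by (simp add: has_vector_derivative_iff_difference_quotient)
  moreover have "eventually (\<lambda>s. 0 \<le> (f s - f t) / (s - t)) (at t within {t0..})"
    unfolding eventually_at_filter
  proof (rule always_eventually, intro allI impI)
    fix s assume "s \<noteq> t" "s \<in> {t0..}"
    then show "0 \<le> (f s - f t) / (s - t)"
      using mono_onD[OF assms(1), of s t] mono_onD[OF assms(1), of t s] assms(3)
      by (cases "s < t") (auto simp: divide_nonneg_nonneg divide_nonpos_nonpos)
  qed
  ultimately show ?thesis
    by (rule tendsto_lowerbound[OF _ _ at_within_half_line_nontrivial[OF assms(3)]])
qed

text \<open>On the half line the derivative is the pointwise limit of right difference quotients of a continuous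
extension of \<open>f\<close>.\<close>

lemma dot_borel_measurable:
  fixes f :: "real \<Rightarrow> real"
  assumes "f differentiable_on {t0..}"
  shows "(\<lambda>t. indicator {t0..} t * dot t0 f t) \<in> borel_measurable borel"
proof (rule borel_measurable_LIMSEQ_real)
  \<comment> \<open>Extending \<open>f\<close> by a constant to the left of \<open>t0\<close> keeps it continuous.\<close>
  define F where "F t = f (max t0 t)" for t
  have "continuous_on UNIV F"
    unfolding F_def using differentiable_imp_continuous_on[OF assms]
    by (rule continuous_on_compose2) (auto intro!: continuous_intros)
  then have F: "F \<in> borel_measurable borel" by (rule borel_measurable_continuous_onI)
  let ?D = "\<lambda>n t. indicator {t0..} t * ((F (t + 1 / real (Suc n)) - F t) / (1 / real (Suc n)))"
  show "?D n \<in> borel_measurable borel" for n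
  proof -
    have "(\<lambda>t. F (t + 1 / real (Suc n))) \<in> borel_measurable borel"
      by (rule measurable_compose[OF _ F]) simp
    then show ?thesis using F by measurable
  qed
  show "(\<lambda>n. ?D n t) \<longlonglongrightarrow> indicator {t0..} t * dot t0 f t" if "t \<in> space borel" for t
  proof (cases "t0 \<le> t")
    case True
    have "((\<lambda>s. (f s - f t) / (s - t)) \<longlongrightarrow> dot t0 f t) (at t within {t0..})"
      using has_vector_derivative_dot[OF assms True] by (simp add: has_vector_derivative_iff_difference_quotient)
    moreover have "filterlim (\<lambda>n. t + 1 / real (Suc n)) (at t within {t0..}) sequentially"
      unfolding filterlim_at
    proof (intro conjI always_eventually allI)
      have "(\<lambda>n. t + 1 / real (Suc n)) \<longlonglongrightarrow> t + 0"
        using LIMSEQ_inverse_real_of_nat by (intro tendsto_intros) (simp add: inverse_eq_divide)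
      then show "(\<lambda>n. t + 1 / real (Suc n)) \<longlonglongrightarrow> t" by simp
    qed (use True in \<open>auto intro: order_trans[of t0 t]\<close>)
    ultimately have "(\<lambda>n. (f (t + 1 / real (Suc n)) - f t) / (t + 1 / real (Suc n) - t)) \<longlonglongrightarrow> dot t0 f t"
      by (rule filterlim_compose)
    moreover have "F (t + 1 / real (Suc n)) = f (t + 1 / real (Suc n))" "F t = f t" for n
      using True by (simp_all add: F_def max_absorb2 add_increasing2)
    ultimately show ?thesis using True by simp
  qed simp
qed

section \<open>Moreau envelopes and proximal points\<close>

locale convex_lsc_function =
  fixes \<Phi> :: "'a::{real_inner, complete_space} \<Rightarrow> ereal"
  assumes proper: "proper_fun \<Phi>" and convex: "convex_fun \<Phi>"
    and lsc: "lower_semicontinuous \<Phi>" and argmin_nonempty: "argmin \<Phi> \<noteq> {}"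
begin

text \<open>The real-valued version of the function; it is meaningful on the effective domain, which contains all minimizers and all
proximal points.\<close>

definition fin_val :: "'a \<Rightarrow> real" where
  "fin_val y = real_of_ereal (\<Phi> y)"

text \<open>The Yosida approximation of the subdifferential. It is a subgradient at the proximal point (\<open>yosida_subgradient\<close>)
and the gradient of the Moreau envelope (\<open>gradient_moreau_envelope\<close>).\<close>

definition yosida :: "real \<Rightarrow> 'a \<Rightarrow> 'a" where
  "yosida \<mu> x = (1 / \<mu>) *\<^sub>R (x - prox \<mu> \<Phi> x)"

definition minimum :: real where
  "minimum = real_of_ereal (min_value \<Phi>)"

lemma finite_iff: "\<Phi> y = ereal (fin_val y) \<longleftrightarrow> \<Phi> y \<noteq> \<infinity>"
  using proper by (cases "\<Phi> y") (auto simp: proper_fun_def fin_val_def)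

lemma minimizer:
  assumes "z \<in> argmin \<Phi>"
  shows "\<Phi> z = ereal minimum"
proof -
  have le: "\<Phi> z \<le> \<Phi> y" for y
    using assms by (auto simp: argmin_def is_arg_min_linorder)
  moreover obtain y where "\<Phi> y \<noteq> \<infinity>" using proper by (auto simp: proper_fun_def)
  ultimately have "\<Phi> z \<noteq> \<infinity>" by (metis ereal_infty_less_eq(1))
  moreover have "min_value \<Phi> = \<Phi> z"
    unfolding min_value_def by (rule antisym[OF INF_lower INF_greatest]) (use le in auto)
  ultimately show ?thesis using finite_iff[of z] by (simp add: minimum_def fin_val_def)
qed

lemma min_value_eq: "min_value \<Phi> = ereal minimum"
proof -
  obtain z where z: "z \<in> argmin \<Phi>" using argmin_nonempty by blast
  have "min_value \<Phi> = \<Phi> z"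
    unfolding min_value_def using z
    by (intro antisym[OF INF_lower INF_greatest]) (auto simp: argmin_def is_arg_min_linorder)
  then show ?thesis using minimizer[OF z] by simp
qed

lemma minimum_le: "ereal minimum \<le> \<Phi> y"
  unfolding min_value_eq[symmetric] min_value_def by (rule INF_lower) simp

lemma convex_real:
  assumes "\<Phi> y = ereal r" "\<Phi> z = ereal s" "0 < u" "u < 1"
  shows "\<exists>q. \<Phi> (u *\<^sub>R y + (1 - u) *\<^sub>R z) = ereal q \<and> q \<le> u * r + (1 - u) * s"
proof -
  have "\<Phi> (u *\<^sub>R y + (1 - u) *\<^sub>R z) \<le> ereal u * \<Phi> y + ereal (1 - u) * \<Phi> z"
    using convex[unfolded convex_fun_def, rule_format, where x = y and y = z and u = u] assms(3,4) by simp
  then have le: "\<Phi> (u *\<^sub>R y + (1 - u) *\<^sub>R z) \<le> ereal (u * r + (1 - u) * s)" using assms by simp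
  then have "\<Phi> (u *\<^sub>R y + (1 - u) *\<^sub>R z) \<noteq> \<infinity>" by auto
  then show ?thesis using le finite_iff by (metis ereal_less_eq(3))
qed

lemma lsc_sequentially:
  assumes "y \<longlonglongrightarrow> p" and le: "eventually (\<lambda>n. \<Phi> (y n) \<le> ereal (c n)) sequentially" and "c \<longlonglongrightarrow> l"
  shows "\<Phi> p \<le> ereal l"
proof (rule ccontr)
  assume "\<not> \<Phi> p \<le> ereal l"
  then obtain k where k: "l < k" "ereal k < \<Phi> p"
    by (metis ereal_dense2 ereal_less_eq(3) less_ereal.simps(1) not_le)
  have "\<Phi> p \<le> Liminf (at p) \<Phi>" using lsc by (simp add: lower_semicontinuous_def)
  then have "ereal k < Liminf (at p) \<Phi>" using k(2) by simp
  then have "eventually (\<lambda>z. ereal k < \<Phi> z) (at p)" by (simp add: less_LiminfD)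
  then have "eventually (\<lambda>z. ereal k < \<Phi> z) (nhds p)"
    unfolding eventually_at_filter by (rule eventually_mono) (use k(2) in auto)
  then have "eventually (\<lambda>n. ereal k < \<Phi> (y n)) sequentially"
    using assms(1) by (auto simp: filterlim_iff)
  moreover have "eventually (\<lambda>n. c n < k) sequentially"
    using assms(3) k(1) by (rule order_tendstoD)
  ultimately have "eventually (\<lambda>n. False) sequentially"
    using le by eventually_elim (metis ereal_less_eq(3) leD le_less_trans less_imp_le)
  then show False by simp
qed

lemma prox_objective_real:
  "\<Phi> y = ereal r \<Longrightarrow> prox_objective \<mu> \<Phi> x y = ereal (r + (norm (x - y))\<^sup>2 / (2 * \<mu>))"
  by (simp add: prox_objective_def)

text \<open>The quadratic term makes the objective strongly convex: by the parallelogram identity, comparing two almost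
minimizers with their midpoint shows that they are close. Hence every minimizing sequence is Cauchy, and lower
semicontinuity makes its limit a minimizer.\<close>

lemma prox_exists:
  assumes "\<mu> > 0"
  shows "\<exists>p. is_arg_min (prox_objective \<mu> \<Phi> x) (\<lambda>_. True) p"
proof -
  define J where "J = prox_objective \<mu> \<Phi> x"
  obtain z where z: "z \<in> argmin \<Phi>" using argmin_nonempty by blast
  have Jlow: "ereal minimum \<le> J y" for y
  proof -
    have "ereal minimum + 0 \<le> \<Phi> y + ereal (1 / (2 * \<mu>) * (norm (x - y))\<^sup>2)"
      using minimum_le assms by (intro add_mono) auto
    then show ?thesis by (simp add: J_def prox_objective_def)
  qed
  have "J z < \<infinity>" by (simp add: J_def prox_objective_def minimizer[OF z])
  then have "(INF y. J y) < \<infinity>" by (meson INF_lower UNIV_I le_less_trans)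
  moreover have "ereal minimum \<le> (INF y. J y)" using Jlow by (intro INF_greatest)
  ultimately obtain m where m: "(INF y. J y) = ereal m" by (cases "INF y. J y") auto
  have mle: "ereal m \<le> J y" for y using m by (metis INF_lower UNIV_I)
  have "\<exists>y. J y < ereal (m + 1 / real (Suc n))" for n
  proof -
    have "(INF y. J y) < ereal (m + 1 / real (Suc n))" using m by simp
    then show ?thesis by (simp only: INF_less_iff) auto
  qed
  then obtain y where y: "\<And>n. J (y n) < ereal (m + 1 / real (Suc n))" by metis
  define r where "r n = fin_val (y n)" for n
  have r: "\<Phi> (y n) = ereal (r n)" for n
  proof -
    have "\<Phi> (y n) \<noteq> \<infinity>" using y[of n] by (auto simp: J_def prox_objective_def)
    then show ?thesis by (simp add: r_def finite_iff)
  qed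
  have Jy: "r n + (norm (x - y n))\<^sup>2 / (2 * \<mu>) < m + 1 / real (Suc n)" for n
    using y[of n] by (simp add: J_def prox_objective_real[OF r])
  have par: "(norm (y n - y k))\<^sup>2 \<le> 4 * \<mu> * (1 / real (Suc n) + 1 / real (Suc k))" for n k
  proof -
    define h where "h = (1 / 2) *\<^sub>R y n + (1 - 1 / 2) *\<^sub>R y k"
    obtain q where q: "\<Phi> h = ereal q" "q \<le> 1 / 2 * r n + (1 - 1 / 2) * r k"
      using convex_real[OF r r, of "1 / 2" n k] unfolding h_def by auto
    have "m \<le> q + (norm (x - h))\<^sup>2 / (2 * \<mu>)"
      using mle[of h] by (simp add: J_def prox_objective_real[OF q(1)])
    moreover have "x - h = (1 / 2) *\<^sub>R ((x - y n) + (x - y k))" "y n - y k = (x - y k) - (x - y n)"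
      by (simp_all add: h_def algebra_simps flip: scaleR_add_left)
    then have "(norm (x - h))\<^sup>2 = (norm (x - y n))\<^sup>2 / 2 + (norm (x - y k))\<^sup>2 / 2 - (norm (y n - y k))\<^sup>2 / 4"
      by (simp only: power2_norm_eq_inner inner_scaleR_left inner_scaleR_right inner_add_left inner_add_right
            inner_diff_left[of "x - y k" "x - y n"] inner_diff_right[of _ "x - y k" "x - y n"] inner_commute[of "x - y k" "x - y n"])
         (simp add: field_simps)
    then have "(norm (x - h))\<^sup>2 / (2 * \<mu>) = ((norm (x - y n))\<^sup>2 / 2 + (norm (x - y k))\<^sup>2 / 2
        - (norm (y n - y k))\<^sup>2 / 4) / (2 * \<mu>)" by simp
    then have "(norm (x - h))\<^sup>2 / (2 * \<mu>) = ((norm (x - y n))\<^sup>2 / (2 * \<mu>)) / 2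
        + ((norm (x - y k))\<^sup>2 / (2 * \<mu>)) / 2 - (norm (y n - y k))\<^sup>2 / (8 * \<mu>)"
      by (simp add: add_divide_distrib diff_divide_distrib mult_ac)
    ultimately have "(norm (y n - y k))\<^sup>2 / (8 * \<mu>) \<le> (1 / real (Suc n) + 1 / real (Suc k)) / 2"
      using q(2) Jy[of n] Jy[of k] by argo
    then have "(norm (y n - y k))\<^sup>2 \<le> (1 / real (Suc n) + 1 / real (Suc k)) / 2 * (8 * \<mu>)"
      using assms by (subst (asm) pos_divide_le_eq) auto
    moreover have "c / 2 * (8 * \<mu>) = 4 * \<mu> * c" for c by simp
    ultimately show ?thesis by (simp only:)
  qed
  have "Cauchy y"
    unfolding Cauchy_altdef2
  proof (intro allI impI)
    fix e :: real assume "e > 0"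
    then have "e\<^sup>2 / (8 * \<mu>) > 0" using assms by simp
    then obtain N where N: "1 / real (Suc N) < e\<^sup>2 / (8 * \<mu>)"
      using nat_approx_posE by metis
    show "\<exists>N. \<forall>n\<ge>N. dist (y n) (y N) < e"
    proof (intro exI allI impI)
      fix n assume "n \<ge> N"
      then have "1 / real (Suc n) \<le> 1 / real (Suc N)" by (simp add: frac_le)
      then have "4 * \<mu> * (1 / real (Suc n) + 1 / real (Suc N)) < 4 * \<mu> * (2 * (e\<^sup>2 / (8 * \<mu>)))"
        using N assms by (intro mult_strict_left_mono) auto
      also have "\<dots> = e\<^sup>2" using assms by simp
      finally have "(norm (y n - y N))\<^sup>2 < e\<^sup>2" using par[of n N] by simp
      then show "dist (y n) (y N) < e"
        using \<open>e > 0\<close> by (simp add: dist_norm power2_less_imp_less)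
    qed
  qed
  \<comment> \<open>The space is complete, so a minimizing sequence has a limit.\<close>
  then obtain p where p: "y \<longlonglongrightarrow> p" using Cauchy_convergent convergent_def by blast
  have "\<Phi> p \<le> ereal (m + 0 - (norm (x - p))\<^sup>2 / (2 * \<mu>))"
  proof (rule lsc_sequentially[OF p])
    show "\<forall>\<^sub>F n in sequentially. \<Phi> (y n) \<le> ereal (m + 1 / real (Suc n) - (norm (x - y n))\<^sup>2 / (2 * \<mu>))"
      using Jy by (intro always_eventually allI) (simp add: r less_imp_le algebra_simps)
    have "(\<lambda>n. 1 / real (Suc n)) \<longlonglongrightarrow> 0" using LIMSEQ_inverse_real_of_nat by (simp add: inverse_eq_divide)
    then show "(\<lambda>n. m + 1 / real (Suc n) - (norm (x - y n))\<^sup>2 / (2 * \<mu>)) \<longlonglongrightarrow> m + 0 - (norm (x - p))\<^sup>2 / (2 * \<mu>)"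
      using p assms by (intro tendsto_intros) auto
  qed
  moreover from this have "\<Phi> p = ereal (fin_val p)" by (subst finite_iff) auto
  ultimately have "J p \<le> ereal m"
    by (metis J_def prox_objective_real ereal_less_eq(3) add.right_neutral le_diff_eq)
  then have "is_arg_min J (\<lambda>_. True) p"
    using mle by (auto simp: is_arg_min_linorder intro: order_trans)
  then show ?thesis unfolding J_def by blast
qed

lemma prox_finite_minimal:
  assumes "\<mu> > 0"
  shows "\<Phi> (prox \<mu> \<Phi> x) = ereal (fin_val (prox \<mu> \<Phi> x))"
    and "prox_objective \<mu> \<Phi> x (prox \<mu> \<Phi> x) \<le> prox_objective \<mu> \<Phi> x y"
proof -
  have min: "is_arg_min (prox_objective \<mu> \<Phi> x) (\<lambda>_. True) (prox \<mu> \<Phi> x)"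
    unfolding prox_def arg_min_def by (rule someI_ex[OF prox_exists[OF assms]])
  then have le: "prox_objective \<mu> \<Phi> x (prox \<mu> \<Phi> x) \<le> prox_objective \<mu> \<Phi> x y" for y
    by (auto simp: is_arg_min_linorder)
  then show "prox_objective \<mu> \<Phi> x (prox \<mu> \<Phi> x) \<le> prox_objective \<mu> \<Phi> x y" .
  obtain z where z: "z \<in> argmin \<Phi>" using argmin_nonempty by blast
  have "prox_objective \<mu> \<Phi> x (prox \<mu> \<Phi> x) \<noteq> \<infinity>"
    using le[of z] by (auto simp: prox_objective_real[OF minimizer[OF z]])
  then have "\<Phi> (prox \<mu> \<Phi> x) \<noteq> \<infinity>" by (auto simp: prox_objective_def)
  then show "\<Phi> (prox \<mu> \<Phi> x) = ereal (fin_val (prox \<mu> \<Phi> x))" by (simp add: finite_iff)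
qed

lemma moreau_envelope_eq:
  assumes "\<mu> > 0"
  shows "moreau_envelope \<mu> \<Phi> x = fin_val (prox \<mu> \<Phi> x) + \<mu> / 2 * (norm (yosida \<mu> x))\<^sup>2"
proof -
  have "(INF y. prox_objective \<mu> \<Phi> x y) = prox_objective \<mu> \<Phi> x (prox \<mu> \<Phi> x)"
    by (rule antisym[OF INF_lower INF_greatest]) (use prox_finite_minimal(2)[OF assms] in auto)
  moreover have "(norm v)\<^sup>2 / (2 * \<mu>) = \<mu> / 2 * (norm ((1 / \<mu>) *\<^sub>R v))\<^sup>2" for v :: 'a
    using assms by (simp add: power2_eq_square field_simps)
  ultimately show ?thesis
    by (simp add: moreau_envelope_def prox_objective_real[OF prox_finite_minimal(1)[OF assms]] yosida_def)
qed

lemma prox_yosida: "\<mu> > 0 \<Longrightarrow> prox \<mu> \<Phi> x = x - \<mu> *\<^sub>R yosida \<mu> x"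
  by (simp add: yosida_def)

text \<open>The optimality condition of the proximal point \<open>p\<close>: moving from \<open>p\<close> towards \<open>y\<close> by a fraction \<open>u\<close> cannot decrease the objective;
dividing the resulting inequality by \<open>u\<close> and letting \<open>u\<close> tend to zero removes the quadratic term.\<close>

lemma yosida_subgradient:
  assumes "\<mu> > 0" and y: "\<Phi> y = ereal r"
  shows "fin_val (prox \<mu> \<Phi> x) + yosida \<mu> x \<bullet> (y - prox \<mu> \<Phi> x) \<le> r"
proof -
  define p where "p = prox \<mu> \<Phi> x"
  define s where "s = fin_val p"
  have p: "\<Phi> p = ereal s" using prox_finite_minimal(1)[OF assms(1)] by (simp add: p_def s_def)
  have key: "s \<le> r - (y - p) \<bullet> (x - p) / \<mu> + u * ((norm (y - p))\<^sup>2 / (2 * \<mu>))" if u: "0 < u" "u < 1" for u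
  proof -
    let ?h = "u *\<^sub>R y + (1 - u) *\<^sub>R p"
    obtain q where q: "\<Phi> ?h = ereal q" "q \<le> u * r + (1 - u) * s" using convex_real[OF y p u] by blast
    have "s + (norm (x - p))\<^sup>2 / (2 * \<mu>) \<le> q + (norm (x - ?h))\<^sup>2 / (2 * \<mu>)"
      using prox_finite_minimal(2)[OF assms(1), of x ?h]
      by (simp add: p_def[symmetric] prox_objective_real[OF q(1)] prox_objective_real[OF p])
    moreover have "(norm (x - ?h))\<^sup>2 = (norm (x - p))\<^sup>2 - 2 * u * ((y - p) \<bullet> (x - p)) + u\<^sup>2 * (norm (y - p))\<^sup>2"
    proof -
      have "x - ?h = (x - p) - u *\<^sub>R (y - p)" by (simp add: algebra_simps)
      moreover have "(norm (a - u *\<^sub>R d))\<^sup>2 = (norm a)\<^sup>2 - 2 * u * (d \<bullet> a) + u\<^sup>2 * (norm d)\<^sup>2" for a d :: 'a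
        unfolding power2_norm_eq_inner
        by (simp add: inner_diff_left inner_diff_right inner_commute power2_eq_square)
      ultimately show ?thesis by metis
    qed
    then have "(norm (x - ?h))\<^sup>2 / (2 * \<mu>) = (norm (x - p))\<^sup>2 / (2 * \<mu>)
        - u * ((y - p) \<bullet> (x - p) / \<mu>) + u * (u * ((norm (y - p))\<^sup>2 / (2 * \<mu>)))"
      using assms(1) by (simp add: add_divide_distrib diff_divide_distrib power2_eq_square)
    ultimately have "0 \<le> u * r - u * s - u * ((y - p) \<bullet> (x - p) / \<mu>) + u * (u * ((norm (y - p))\<^sup>2 / (2 * \<mu>)))"
      using q(2) by (simp add: left_diff_distrib)
    then have "0 \<le> u * (r - s - (y - p) \<bullet> (x - p) / \<mu> + u * ((norm (y - p))\<^sup>2 / (2 * \<mu>)))"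
      by (simp only: right_diff_distrib distrib_left)
    then show ?thesis using u by (simp add: zero_le_mult_iff)
  qed
  have "((\<lambda>u. r - (y - p) \<bullet> (x - p) / \<mu> + u * ((norm (y - p))\<^sup>2 / (2 * \<mu>)))
      \<longlongrightarrow> r - (y - p) \<bullet> (x - p) / \<mu> + 0 * ((norm (y - p))\<^sup>2 / (2 * \<mu>))) (at_right 0)"
    by (intro tendsto_intros)
  moreover have "eventually (\<lambda>u. s \<le> r - (y - p) \<bullet> (x - p) / \<mu> + u * ((norm (y - p))\<^sup>2 / (2 * \<mu>))) (at_right 0)"
    unfolding eventually_at_right_field by (intro exI[of _ 1] conjI allI impI key) simp_all
  ultimately have "s \<le> r - (y - p) \<bullet> (x - p) / \<mu> + 0 * ((norm (y - p))\<^sup>2 / (2 * \<mu>))"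
    by (rule tendsto_lowerbound) simp
  then show ?thesis by (simp add: yosida_def p_def[symmetric] s_def inner_commute)
qed

text \<open>Joint convexity in point and parameter, in the form needed to differentiate along a curve. It is the
subgradient inequality between two proximal points, in which the quadratic terms combine into the square
\<open>\<nu> / 2 * (norm (yosida \<nu> y - yosida \<mu> x))\<^sup>2\<close>, which is dropped.\<close>

lemma moreau_envelope_lower_bound:
  assumes "\<mu> > 0" "\<nu> > 0"
  shows "moreau_envelope \<mu> \<Phi> x + yosida \<mu> x \<bullet> (y - x) - (\<nu> - \<mu>) / 2 * (norm (yosida \<mu> x))\<^sup>2
      \<le> moreau_envelope \<nu> \<Phi> y"
proof -
  have "fin_val (prox \<mu> \<Phi> x) + yosida \<mu> x \<bullet> (prox \<nu> \<Phi> y - prox \<mu> \<Phi> x) \<le> fin_val (prox \<nu> \<Phi> y)"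
    by (rule yosida_subgradient[OF assms(1) prox_finite_minimal(1)[OF assms(2)]])
  moreover have "prox \<nu> \<Phi> y - prox \<mu> \<Phi> x = (y - x) - \<nu> *\<^sub>R yosida \<nu> y + \<mu> *\<^sub>R yosida \<mu> x"
    using assms by (simp add: prox_yosida)
  moreover have "0 \<le> \<nu> / 2 * (norm (yosida \<nu> y - yosida \<mu> x))\<^sup>2" using assms by simp
  moreover have "(norm (yosida \<nu> y - yosida \<mu> x))\<^sup>2 = (norm (yosida \<nu> y))\<^sup>2
      - 2 * (yosida \<mu> x \<bullet> yosida \<nu> y) + (norm (yosida \<mu> x))\<^sup>2"
    by (simp add: power2_norm_eq_inner algebra_simps inner_commute)
  ultimately show ?thesis
    using assms by (simp add: moreau_envelope_eq inner_diff_right inner_add_right power2_norm_eq_inner[symmetric] field_simps)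
qed

text \<open>The proximal point of \<open>x\<close> is a competitor in the minimization that defines the envelope at \<open>y\<close>.\<close>

lemma moreau_envelope_upper_bound:
  assumes "\<mu> > 0"
  shows "moreau_envelope \<mu> \<Phi> y \<le> moreau_envelope \<mu> \<Phi> x + yosida \<mu> x \<bullet> (y - x) + (norm (y - x))\<^sup>2 / (2 * \<mu>)"
proof -
  let ?p = "prox \<mu> \<Phi> x"
  have "fin_val (prox \<mu> \<Phi> y) + (norm (y - prox \<mu> \<Phi> y))\<^sup>2 / (2 * \<mu>) \<le> fin_val ?p + (norm (y - ?p))\<^sup>2 / (2 * \<mu>)"
    using prox_finite_minimal(2)[OF assms, of y ?p]
    by (simp add: prox_objective_real[OF prox_finite_minimal(1)[OF assms]])
  moreover have "y - prox \<mu> \<Phi> y = \<mu> *\<^sub>R yosida \<mu> y" using prox_yosida[OF assms] by simp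
  moreover have "y - ?p = (y - x) + \<mu> *\<^sub>R yosida \<mu> x" using prox_yosida[OF assms] by simp
  moreover have "(norm ((y - x) + \<mu> *\<^sub>R yosida \<mu> x))\<^sup>2 = (norm (y - x))\<^sup>2 + 2 * \<mu> * (yosida \<mu> x \<bullet> (y - x))
      + \<mu>\<^sup>2 * (norm (yosida \<mu> x))\<^sup>2"
    unfolding power2_norm_eq_inner by (simp add: inner_add_left inner_add_right inner_commute power2_eq_square)
  then have "(norm ((y - x) + \<mu> *\<^sub>R yosida \<mu> x))\<^sup>2 / (2 * \<mu>)
      = (norm (y - x))\<^sup>2 / (2 * \<mu>) + yosida \<mu> x \<bullet> (y - x) + \<mu> / 2 * (norm (yosida \<mu> x))\<^sup>2"
    using assms by (simp add: add_divide_distrib power2_eq_square)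
  moreover have "(norm (\<mu> *\<^sub>R yosida \<mu> y))\<^sup>2 / (2 * \<mu>) = \<mu> / 2 * (norm (yosida \<mu> y))\<^sup>2"
    using assms by (simp add: power2_eq_square)
  ultimately show ?thesis by (simp only: moreau_envelope_eq[OF assms])
qed

lemma gradient_moreau_envelope:
  assumes "\<mu> > 0"
  shows "gradient (moreau_envelope \<mu> \<Phi>) x = yosida \<mu> x"
proof -
  have "GDERIV (moreau_envelope \<mu> \<Phi>) x :> yosida \<mu> x"
    unfolding gderiv_def has_derivative_at2
  proof (intro conjI)
    show "bounded_linear (\<lambda>h. h \<bullet> yosida \<mu> x)" by (rule bounded_linear_inner_left)
    let ?R = "\<lambda>y. moreau_envelope \<mu> \<Phi> y - (moreau_envelope \<mu> \<Phi> x + (y - x) \<bullet> yosida \<mu> x)"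
    show "((\<lambda>y. (1 / norm (y - x)) *\<^sub>R ?R y) \<longlongrightarrow> 0) (at x)"
    proof (rule Lim_null_comparison)
      show "\<forall>\<^sub>F y in at x. norm ((1 / norm (y - x)) *\<^sub>R ?R y) \<le> norm (y - x) / (2 * \<mu>)"
      proof (rule always_eventually, rule allI)
        fix y
        have "0 \<le> ?R y" "?R y \<le> (norm (y - x))\<^sup>2 / (2 * \<mu>)"
          using moreau_envelope_lower_bound[OF assms assms, of x y] moreau_envelope_upper_bound[OF assms, of y x]
          by (simp_all add: inner_commute)
        then have "\<bar>?R y\<bar> / norm (y - x) \<le> (norm (y - x))\<^sup>2 / (2 * \<mu>) / norm (y - x)"
          by (intro divide_right_mono) auto
        then show "norm ((1 / norm (y - x)) *\<^sub>R ?R y) \<le> norm (y - x) / (2 * \<mu>)"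
          by (cases "y = x") (simp_all add: power2_eq_square)
      qed
      have "((\<lambda>y. norm (y - x) / (2 * \<mu>)) \<longlongrightarrow> norm (x - x) / (2 * \<mu>)) (at x)"
        using assms by (intro tendsto_intros) auto
      then show "((\<lambda>y. norm (y - x) / (2 * \<mu>)) \<longlongrightarrow> 0) (at x)" by simp
    qed
  qed
  moreover have "D = yosida \<mu> x" if "GDERIV (moreau_envelope \<mu> \<Phi>) x :> D" for D
  proof -
    have "(\<lambda>h. h \<bullet> D) = (\<lambda>h. h \<bullet> yosida \<mu> x)"
      using that calculation unfolding gderiv_def by (rule has_derivative_unique)
    then have "(D - yosida \<mu> x) \<bullet> D = (D - yosida \<mu> x) \<bullet> yosida \<mu> x" by metis
    then have "(D - yosida \<mu> x) \<bullet> (D - yosida \<mu> x) = 0" by (simp add: inner_diff_right)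
    then show ?thesis by simp
  qed
  ultimately show ?thesis unfolding gradient_def by (rule the_equality)
qed

lemma envelope_minus_minimum_ge:
  assumes "\<mu> > 0"
  shows "fin_val (prox \<mu> \<Phi> x) - minimum \<le> moreau_envelope \<mu> \<Phi> x - minimum"
    and "\<mu> / 2 * (norm (yosida \<mu> x))\<^sup>2 \<le> moreau_envelope \<mu> \<Phi> x - minimum"
    and "0 \<le> fin_val (prox \<mu> \<Phi> x) - minimum"
proof -
  have "ereal minimum \<le> ereal (fin_val (prox \<mu> \<Phi> x))"
    using minimum_le[of "prox \<mu> \<Phi> x"] prox_finite_minimal(1)[OF assms, of x] by simp
  then show "0 \<le> fin_val (prox \<mu> \<Phi> x) - minimum"
    "\<mu> / 2 * (norm (yosida \<mu> x))\<^sup>2 \<le> moreau_envelope \<mu> \<Phi> x - minimum" by (auto simp: moreau_envelope_eq[OF assms])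
  show "fin_val (prox \<mu> \<Phi> x) - minimum \<le> moreau_envelope \<mu> \<Phi> x - minimum"
    using assms by (simp add: moreau_envelope_eq[OF assms])
qed

text \<open>The subgradient inequality at the proximal point, tested with a minimizer.\<close>

lemma yosida_inner_minimizer:
  assumes "\<mu> > 0" "z \<in> argmin \<Phi>"
  shows "moreau_envelope \<mu> \<Phi> x - minimum + \<mu> / 2 * (norm (yosida \<mu> x))\<^sup>2 \<le> yosida \<mu> x \<bullet> (x - z)"
proof -
  have "fin_val (prox \<mu> \<Phi> x) + yosida \<mu> x \<bullet> (z - prox \<mu> \<Phi> x) \<le> minimum"
    by (rule yosida_subgradient[OF assms(1) minimizer[OF assms(2)]])
  moreover have "z - prox \<mu> \<Phi> x = \<mu> *\<^sub>R yosida \<mu> x - (x - z)" by (simp add: prox_yosida[OF assms(1)])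
  ultimately show ?thesis
    by (simp add: moreau_envelope_eq[OF assms(1)] inner_diff_right power2_norm_eq_inner)
qed

lemma yosida_norm_bound:
  assumes "\<mu> > 0" "z \<in> argmin \<Phi>"
  shows "\<mu> * norm (yosida \<mu> x) \<le> norm (x - z)"
proof -
  have "\<mu> * (norm (yosida \<mu> x))\<^sup>2 \<le> yosida \<mu> x \<bullet> (x - z)"
    using yosida_inner_minimizer[OF assms, of x] envelope_minus_minimum_ge(2)[OF assms(1), of x] by simp
  also have "\<dots> \<le> norm (yosida \<mu> x) * norm (x - z)" by (rule norm_cauchy_schwarz)
  finally have "norm (yosida \<mu> x) * (\<mu> * norm (yosida \<mu> x)) \<le> norm (yosida \<mu> x) * norm (x - z)"
    by (simp add: power2_eq_square algebra_simps)
  then show ?thesis by (cases "yosida \<mu> x = 0") (auto simp: mult_le_cancel_left_pos)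
qed

text \<open>Monotonicity of the subdifferential between the two proximal points, which are written here as
\<open>y - \<nu> *\<^sub>R yosida \<nu> y\<close> and \<open>x - \<mu> *\<^sub>R yosida \<mu> x\<close>.\<close>

lemma prox_yosida_monotone:
  assumes "\<mu> > 0" "\<nu> > 0"
  shows "0 \<le> (yosida \<nu> y - yosida \<mu> x) \<bullet> ((y - \<nu> *\<^sub>R yosida \<nu> y) - (x - \<mu> *\<^sub>R yosida \<mu> x))"
proof -
  let ?p = "prox \<mu> \<Phi> x" and ?q = "prox \<nu> \<Phi> y"
  have "fin_val ?p + yosida \<mu> x \<bullet> (?q - ?p) \<le> fin_val ?q"
    "fin_val ?q + yosida \<nu> y \<bullet> (?p - ?q) \<le> fin_val ?p"
    using assms by (auto intro!: yosida_subgradient prox_finite_minimal(1))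
  moreover have "yosida \<nu> y \<bullet> (?p - ?q) = - (yosida \<nu> y \<bullet> (?q - ?p))"
    by (simp add: inner_diff_right)
  ultimately have "0 \<le> (yosida \<nu> y - yosida \<mu> x) \<bullet> (?q - ?p)"
    by (simp only: inner_diff_left)
  then show ?thesis by (simp only: prox_yosida[OF assms(1)] prox_yosida[OF assms(2)])
qed

lemma yosida_monotone:
  assumes "\<mu> > 0"
  shows "0 \<le> (yosida \<mu> y - yosida \<mu> x) \<bullet> (y - x)"
proof -
  have "(yosida \<mu> y - yosida \<mu> x) \<bullet> ((y - \<mu> *\<^sub>R yosida \<mu> y) - (x - \<mu> *\<^sub>R yosida \<mu> x))
    = (yosida \<mu> y - yosida \<mu> x) \<bullet> (y - x) - \<mu> * ((yosida \<mu> y - yosida \<mu> x) \<bullet> (yosida \<mu> y - yosida \<mu> x))"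
    by (simp add: inner_diff_left inner_diff_right algebra_simps)
  then show ?thesis
    using prox_yosida_monotone[OF assms assms, of y x] assms
    by (smt (verit) inner_ge_zero mult_nonneg_nonneg)
qed

lemma yosida_parameter_lipschitz:
  assumes "\<mu> > 0" "\<nu> > 0"
  shows "\<nu> * norm (yosida \<nu> x - yosida \<mu> x) \<le> \<bar>\<nu> - \<mu>\<bar> * norm (yosida \<mu> x)"
proof -
  define d where "d = yosida \<nu> x - yosida \<mu> x"
  have "(x - \<nu> *\<^sub>R yosida \<nu> x) - (x - \<mu> *\<^sub>R yosida \<mu> x) = - (\<nu> *\<^sub>R d) - (\<nu> - \<mu>) *\<^sub>R yosida \<mu> x"
    by (simp add: d_def algebra_simps)
  then have "0 \<le> d \<bullet> (- (\<nu> *\<^sub>R d) - (\<nu> - \<mu>) *\<^sub>R yosida \<mu> x)"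
    using prox_yosida_monotone[OF assms, of x x] by (simp only: d_def)
  then have "\<nu> * (d \<bullet> d) \<le> - (\<nu> - \<mu>) * (d \<bullet> yosida \<mu> x)"
    by (simp add: inner_diff_right algebra_simps)
  also have "\<dots> \<le> \<bar>- (\<nu> - \<mu>)\<bar> * \<bar>d \<bullet> yosida \<mu> x\<bar>" by (metis abs_ge_self abs_mult)
  also have "\<dots> \<le> \<bar>\<nu> - \<mu>\<bar> * (norm d * norm (yosida \<mu> x))"
    using Cauchy_Schwarz_ineq2[of d "yosida \<mu> x"] by (intro mult_mono) auto
  finally have "norm d * (\<nu> * norm d) \<le> norm d * (\<bar>\<nu> - \<mu>\<bar> * norm (yosida \<mu> x))"
    by (simp add: power2_norm_eq_inner[symmetric] power2_eq_square algebra_simps)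
  then have "\<nu> * norm d \<le> \<bar>\<nu> - \<mu>\<bar> * norm (yosida \<mu> x)"
    by (cases "d = 0") (auto simp: mult_le_cancel_left_pos)
  then show ?thesis by (simp only: d_def)
qed

text \<open>The increment splits into a change of the point at fixed parameter, which contributes a nonnegative
amount by monotonicity, and a change of the parameter at fixed point, which is Lipschitz.\<close>

lemma yosida_increment_inner:
  assumes "\<mu> > 0" "\<nu> > 0"
  shows "- (norm (y - x) * (\<bar>\<nu> - \<mu>\<bar> / \<nu>) * norm (yosida \<mu> x)) \<le> (y - x) \<bullet> (yosida \<nu> y - yosida \<mu> x)"
proof -
  have "(y - x) \<bullet> (yosida \<nu> y - yosida \<mu> x)
      = (yosida \<nu> y - yosida \<nu> x) \<bullet> (y - x) + (y - x) \<bullet> (yosida \<nu> x - yosida \<mu> x)"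
    by (simp add: inner_diff_left inner_diff_right inner_commute)
  moreover have "\<bar>(y - x) \<bullet> (yosida \<nu> x - yosida \<mu> x)\<bar> \<le> norm (y - x) * norm (yosida \<nu> x - yosida \<mu> x)"
    by (rule Cauchy_Schwarz_ineq2)
  moreover have "norm (yosida \<nu> x - yosida \<mu> x) \<le> \<bar>\<nu> - \<mu>\<bar> / \<nu> * norm (yosida \<mu> x)"
    using yosida_parameter_lipschitz[OF assms, of x] assms by (simp add: field_simps)
  then have "norm (y - x) * norm (yosida \<nu> x - yosida \<mu> x) \<le> norm (y - x) * (\<bar>\<nu> - \<mu>\<bar> / \<nu> * norm (yosida \<mu> x))"
    by (intro mult_left_mono) auto
  ultimately show ?thesis using yosida_monotone[OF assms(2), of y x] by simp
qed

text \<open>By the joint lower bound, used from \<open>t\<close> to \<open>s\<close> and from \<open>s\<close> to \<open>t\<close>, the increment of the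
envelope lies between the linearizations at \<open>t\<close> and at \<open>s\<close>. Their difference quotients have the same limit as soon as the
gradient is continuous along the curve.\<close>

lemma moreau_envelope_along_curve:
  assumes "t \<in> S" and pos: "\<And>s. s \<in> S \<Longrightarrow> lam s > 0"
    and x: "(x has_vector_derivative x') (at t within S)"
    and lam: "(lam has_vector_derivative lam') (at t within S)"
    and cont: "((\<lambda>s. yosida (lam s) (x s)) \<longlongrightarrow> yosida (lam t) (x t)) (at t within S)"
  shows "((\<lambda>s. moreau_envelope (lam s) \<Phi> (x s)) has_vector_derivative
      yosida (lam t) (x t) \<bullet> x' - lam' / 2 * (norm (yosida (lam t) (x t)))\<^sup>2) (at t within S)"
proof -
  define g where "g s = yosida (lam s) (x s)" for s
  define A where "A s r = g r \<bullet> ((1 / (s - t)) *\<^sub>R (x s - x t)) - (lam s - lam t) / (s - t) / 2 * (norm (g r))\<^sup>2" for s r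
  have g: "(g \<longlongrightarrow> g t) (at t within S)" using cont by (simp add: g_def[abs_def])
  have x_lim: "((\<lambda>s. (1 / (s - t)) *\<^sub>R (x s - x t)) \<longlongrightarrow> x') (at t within S)"
    using x by (simp add: has_vector_derivative_iff_difference_quotient)
  have lam_lim: "((\<lambda>s. (lam s - lam t) / (s - t)) \<longlongrightarrow> lam') (at t within S)"
    using lam by (simp add: has_vector_derivative_iff_difference_quotient)
  let ?L = "g t \<bullet> x' - lam' / 2 * (norm (g t))\<^sup>2"
  have lims: "((\<lambda>s. A s t) \<longlongrightarrow> ?L) (at t within S)" "((\<lambda>s. A s s) \<longlongrightarrow> ?L) (at t within S)"
    unfolding A_def by (intro tendsto_intros x_lim lam_lim g; simp)+
  have lim: "((\<lambda>s. min (A s t) (A s s)) \<longlongrightarrow> ?L) (at t within S)"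
    "((\<lambda>s. max (A s t) (A s s)) \<longlongrightarrow> ?L) (at t within S)"
    using tendsto_min[OF lims] tendsto_max[OF lims] by simp_all
  define h where "h s = moreau_envelope (lam s) \<Phi> (x s)" for s
  have between: "min (A s t) (A s s) \<le> (h s - h t) / (s - t) \<and> (h s - h t) / (s - t) \<le> max (A s t) (A s s)"
    if "s \<in> S" "s \<noteq> t" for s
  proof -
    define Q where "Q r = g r \<bullet> (x s - x t) - (lam s - lam t) / 2 * (norm (g r))\<^sup>2" for r
    have A: "A s r = Q r / (s - t)" for r
      unfolding A_def Q_def
      by (simp add: diff_divide_distrib[of "g r \<bullet> (x s - x t)"] mult.commute)
    have "Q t \<le> h s - h t"
      using moreau_envelope_lower_bound[OF pos[OF \<open>t \<in> S\<close>] pos[OF that(1)], of "x t" "x s"]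
      by (simp add: Q_def h_def g_def)
    moreover have "h s - h t \<le> Q s"
    proof -
      have "(lam t - lam s) / 2 * (norm (g s))\<^sup>2 = - ((lam s - lam t) / 2 * (norm (g s))\<^sup>2)"
        "g s \<bullet> (x t - x s) = - (g s \<bullet> (x s - x t))"
        by (simp_all add: field_simps inner_diff_right)
      then show ?thesis
        using moreau_envelope_lower_bound[OF pos[OF that(1)] pos[OF \<open>t \<in> S\<close>], of "x s" "x t"]
        by (simp add: Q_def h_def g_def)
    qed
    ultimately show ?thesis
      unfolding A using that(2)
      by (cases "s > t") (auto simp: min_le_iff_disj le_max_iff_disj divide_right_mono divide_right_mono_neg)
  qed
  have "((\<lambda>s. (h s - h t) / (s - t)) \<longlongrightarrow> ?L) (at t within S)"
    by (rule tendsto_sandwich[OF _ _ lim], unfold eventually_at_filter)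
      (rule always_eventually, use between in blast)+
  then have "(h has_vector_derivative ?L) (at t within S)"
    by (simp add: has_vector_derivative_iff_difference_quotient)
  then show ?thesis by (simp add: h_def[abs_def] g_def)
qed

text \<open>The infinitesimal form of \<open>yosida_increment_inner\<close>: even though the parameter moves, the gradient along a curve is
monotone up to an error controlled by the speed of the parameter.\<close>

lemma yosida_derivative_inner:
  assumes "t \<in> S" "at t within S \<noteq> bot" and pos: "\<And>s. s \<in> S \<Longrightarrow> lam s > 0"
    and x: "(x has_vector_derivative x') (at t within S)"
    and lam: "(lam has_vector_derivative lam') (at t within S)"
    and g: "((\<lambda>s. yosida (lam s) (x s)) has_vector_derivative g') (at t within S)"
  shows "- (norm x' * (\<bar>lam'\<bar> / lam t) * norm (yosida (lam t) (x t))) \<le> x' \<bullet> g'"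
proof -
  let ?g = "\<lambda>s. yosida (lam s) (x s)"
  let ?X = "\<lambda>s. (1 / (s - t)) *\<^sub>R (x s - x t)" and ?G = "\<lambda>s. (1 / (s - t)) *\<^sub>R (?g s - ?g t)"
    and ?\<Lambda> = "\<lambda>s. (lam s - lam t) / (s - t)"
  have lims: "(?X \<longlongrightarrow> x') (at t within S)" "(?G \<longlongrightarrow> g') (at t within S)" "(?\<Lambda> \<longlongrightarrow> lam') (at t within S)"
    using x g lam by (simp_all add: has_vector_derivative_iff_difference_quotient)
  have lam_cont: "(lam \<longlongrightarrow> lam t) (at t within S)"
    using has_vector_derivative_continuous[OF lam] by (simp add: continuous_within)
  have lt: "lam t > 0" using assms(1) pos by blast
  have "((\<lambda>s. ?X s \<bullet> ?G s) \<longlongrightarrow> x' \<bullet> g') (at t within S)"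
    by (intro tendsto_intros lims)
  moreover have "((\<lambda>s. - (norm (?X s) * (\<bar>?\<Lambda> s\<bar> / lam s) * norm (?g t)))
      \<longlongrightarrow> - (norm x' * (\<bar>lam'\<bar> / lam t) * norm (?g t))) (at t within S)"
    by (intro tendsto_intros lims lam_cont) (use lt in simp)
  moreover have "eventually (\<lambda>s. - (norm (?X s) * (\<bar>?\<Lambda> s\<bar> / lam s) * norm (?g t)) \<le> ?X s \<bullet> ?G s) (at t within S)"
    unfolding eventually_at_filter
  proof (intro always_eventually allI impI)
    fix s assume "s \<noteq> t" "s \<in> S"
    have "- (norm (x s - x t) * (\<bar>lam s - lam t\<bar> / lam s) * norm (?g t)) / (s - t)\<^sup>2
        \<le> ((x s - x t) \<bullet> (?g s - ?g t)) / (s - t)\<^sup>2"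
      by (intro divide_right_mono yosida_increment_inner pos \<open>s \<in> S\<close> assms(1)) auto
    moreover have "(s - t)\<^sup>2 = \<bar>s - t\<bar> * \<bar>s - t\<bar>" by (simp add: power2_eq_square)
    ultimately show "- (norm (?X s) * (\<bar>?\<Lambda> s\<bar> / lam s) * norm (?g t)) \<le> ?X s \<bullet> ?G s"
      by (simp add: power2_eq_square abs_divide divide_simps mult_ac)
  qed
  ultimately show ?thesis by (rule tendsto_le[OF assms(2)])
qed

end

section \<open>Energies with integrable dissipation\<close>

text \<open>After a late time \<open>T1\<close> the energy \<open>W\<close> can increase by at most \<open>e / 2\<close>, because \<open>q\<close> and \<open>\<theta>\<close> have bounded integrals.
It must drop below \<open>e / 2\<close> at some later time, since otherwise \<open>q t \<ge> e / (2 * t)\<close>, whose integral diverges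
logarithmically.\<close>

lemma dissipation_tendsto_zero:
  fixes W q \<theta> :: "real \<Rightarrow> real"
  assumes "t0 > 0" "K \<ge> 0"
    and W0: "\<And>t. t \<ge> t0 \<Longrightarrow> 0 \<le> W t" and Wq: "\<And>t. t \<ge> t0 \<Longrightarrow> W t \<le> t * q t"
    and q: "\<And>t. t \<ge> t0 \<Longrightarrow> 0 \<le> q t" "\<And>s T. t0 \<le> s \<Longrightarrow> q integrable_on {s..T}"
    and qB: "\<And>T. t0 \<le> T \<Longrightarrow> integral {t0..T} q \<le> B"
    and \<theta>: "\<And>t. t \<ge> t0 \<Longrightarrow> 0 \<le> \<theta> t" "\<And>s T. t0 \<le> s \<Longrightarrow> \<theta> integrable_on {s..T}"
    and \<theta>B: "\<And>T. t0 \<le> T \<Longrightarrow> integral {t0..T} \<theta> \<le> B'"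
    and W: "\<And>s T. t0 \<le> s \<Longrightarrow> s \<le> T \<Longrightarrow> W T - W s \<le> integral {s..T} (\<lambda>t. K * q t + \<theta> t)"
  shows "(W \<longlongrightarrow> 0) at_top"
proof -
  define p where "p t = K * q t + \<theta> t" for t
  define P where "P T = integral {t0..T} p" for T
  have p0: "0 \<le> p t" if "t \<ge> t0" for t using q(1)[OF that] \<theta>(1)[OF that] \<open>K \<ge> 0\<close> by (simp add: p_def)
  have pI: "p integrable_on {s..T}" if "t0 \<le> s" for s T
    unfolding p_def[abs_def] using q(2)[OF that] \<theta>(2)[OF that] by (intro integrable_add integrable_on_mult_right)
  have Pdiff: "P T - P s = integral {s..T} p" if "t0 \<le> s" "s \<le> T" for s T
    unfolding P_def using Henstock_Kurzweil_Integration.integral_combine[OF that pI[OF order_refl]] by simp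
  have Pmono: "P s \<le> P T" if "t0 \<le> s" "s \<le> T" for s T
    using Pdiff[OF that] integral_nonneg[OF pI[OF that(1), of T]] p0 that by auto
  have Pbdd: "P T \<le> K * B + B'" if "t0 \<le> T" for T
  proof -
    have "P T = K * integral {t0..T} q + integral {t0..T} \<theta>"
      unfolding P_def p_def[abs_def] using q(2)[OF order_refl, of T] \<theta>(2)[OF order_refl, of T]
      by (subst integral_add) (auto intro: integrable_on_mult_right)
    also have "\<dots> \<le> K * B + B'" using qB[OF that] \<theta>B[OF that] \<open>K \<ge> 0\<close> by (intro add_mono mult_left_mono)
    finally show ?thesis .
  qed
  have bdd: "bdd_above (P ` {t0..})" using Pbdd by (auto intro!: bdd_aboveI2)
  show ?thesis
    unfolding tendsto_iff
  proof (intro allI impI)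
    fix e :: real assume "e > 0"
    have "(SUP T\<in>{t0..}. P T) - e / 2 < (SUP T\<in>{t0..}. P T)" using \<open>e > 0\<close> by simp
    then obtain T1 where T1: "T1 \<ge> t0" "(SUP T\<in>{t0..}. P T) - e / 2 < P T1"
      by (subst (asm) less_cSUP_iff[OF _ bdd]) auto
    have tail: "P T - P s < e / 2" if "T1 \<le> s" "s \<le> T" for s T
      using cSUP_upper[OF _ bdd, of T] Pmono[of T1 s] T1 that by auto
    have "\<exists>s\<ge>T1. W s < e / 2"
    proof (rule ccontr)
      assume "\<not> (\<exists>s\<ge>T1. W s < e / 2)"
      then have big: "e / 2 \<le> t * q t" if "t \<ge> T1" for t
        using that Wq[of t] T1(1) by (force simp: not_less)
      \<comment> \<open>At this time the lower bound for the integral of \<open>q\<close> equals \<open>B + 1\<close>.\<close>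
      define T where "T = T1 * exp (2 * (B + 1) / e)"
      have B0: "0 \<le> B" using qB[of t0] by simp
      have "T1 > 0" using T1 \<open>t0 > 0\<close> by simp
      have "1 \<le> exp (2 * (B + 1) / e)" using B0 \<open>e > 0\<close> by simp
      then have "T1 \<le> T" using \<open>T1 > 0\<close> unfolding T_def by (simp add: mult_le_cancel_left1)
      have "((\<lambda>t. e / 2 * (1 / t)) has_integral (e / 2 * ln T - e / 2 * ln T1)) {T1..T}"
        using \<open>T1 \<le> T\<close> \<open>T1 > 0\<close>
        by (intro fundamental_theorem_of_calculus)
           (auto intro!: derivative_eq_intros simp: has_real_derivative_iff_has_vector_derivative[symmetric])
      moreover have "(q has_integral integral {T1..T} q) {T1..T}"
        using q(2)[OF T1(1)] by (simp add: has_integral_integral[symmetric])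
      ultimately have "e / 2 * ln T - e / 2 * ln T1 \<le> integral {T1..T} q"
      proof (rule has_integral_le)
        fix t assume "t \<in> {T1..T}"
        then show "e / 2 * (1 / t) \<le> q t" using big[of t] \<open>T1 > 0\<close> by (simp add: field_simps)
      qed
      also have "\<dots> \<le> integral {t0..T} q"
        using T1 q by (intro integral_subset_le) auto
      also have "\<dots> \<le> B" using T1 \<open>T1 \<le> T\<close> by (intro qB) simp
      finally have "e / 2 * (ln T - ln T1) \<le> B" by (simp add: right_diff_distrib)
      moreover have "ln T - ln T1 = 2 * (B + 1) / e" using \<open>T1 > 0\<close> by (simp add: T_def ln_mult)
      ultimately show False using \<open>e > 0\<close> by simp
    qed
    then obtain s where s: "s \<ge> T1" "W s < e / 2" by blast
    have "dist (W T) 0 < e" if "T \<ge> s" for T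
      using W[of s T] Pdiff[of s T] tail[of s T] s that T1(1) W0[of T]
      by (simp add: p_def[abs_def])
    then show "eventually (\<lambda>T. dist (W T) 0 < e) at_top"
      unfolding eventually_at_top_linorder by blast
  qed
qed

section \<open>Lyapunov analysis of the inertial dynamics\<close>

locale inertial_solution = convex_lsc_function \<Phi>
  for \<Phi> :: "'a::{real_inner, complete_space} \<Rightarrow> ereal" +
  fixes \<alpha> t0 \<epsilon> C :: real and \<beta> b lam :: "real \<Rightarrow> real" and x :: "real \<Rightarrow> 'a"
  assumes t0_pos: "t0 > 0"
    and \<beta>_nonneg: "t0 \<le> t \<Longrightarrow> 0 \<le> \<beta> t"
    and b_pos: "t0 \<le> t \<Longrightarrow> 0 < b t"
    and lam_pos: "t0 \<le> t \<Longrightarrow> 0 < lam t"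
    and b_diff: "b differentiable_on {t0..}"
    and lam_diff: "lam differentiable_on {t0..}"
    and \<beta>_diff: "\<beta> differentiable_on {t0..}"
    and \<beta>'_diff: "dot t0 \<beta> differentiable_on {t0..}"
    and \<alpha>_gt_1: "1 < \<alpha>"
    and \<epsilon>: "0 < \<epsilon>" "\<epsilon> < \<alpha> - 1"
    and growth: "t0 \<le> t \<Longrightarrow> \<epsilon> * b t \<le> (\<alpha> - 3) * w_fun t0 \<beta> b t - t * dot t0 (w_fun t0 \<beta> b) t"
    and lam_mono: "mono_on {t0..} lam"
    and w_pos: "t0 \<le> t \<Longrightarrow> dot t0 \<beta> t + \<beta> t / t < b t"
    and slack_finite: "(\<integral>\<^sup>+ t\<in>{t0..}. ennreal (max 0
            ((dot t0 lam t)\<^sup>2 * t ^ 3 * (\<beta> t)\<^sup>2 / (lam t) ^ 4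
              - dot t0 lam t * t\<^sup>2 * b t / (2 * (lam t)\<^sup>2))) \<partial>lborel) < \<infinity>"
    and C_pos: "0 < C"
    and b_growth: "t0 \<le> t \<Longrightarrow> dot t0 (\<lambda>s. s\<^sup>2 * b s) t \<le> C * t * b t"
    and solution: "is_solution \<Phi> \<alpha> t0 \<beta> b lam x"
begin

abbreviation "v \<equiv> dot t0 x"
abbreviation "w \<equiv> w_fun t0 \<beta> b"

definition g :: "real \<Rightarrow> 'a" where "g = moreau_gradient_along \<Phi> lam x"

definition gap :: "real \<Rightarrow> real" where "gap t = moreau_envelope (lam t) \<Phi> (x t) - minimum"

text \<open>The integrand of the integrability hypothesis, which absorbs the errors caused by the motion of \<open>lam\<close>.\<close>

definition slack :: "real \<Rightarrow> real" where
  "slack t = max 0 ((dot t0 lam t)\<^sup>2 * t ^ 3 * (\<beta> t)\<^sup>2 / (lam t) ^ 4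
              - dot t0 lam t * t\<^sup>2 * b t / (2 * (lam t)\<^sup>2))"

text \<open>The dissipation rate \<open>q\<close>: up to the factor \<open>\<epsilon> / 2\<close> it bounds the decrease of the Lyapunov function.\<close>

definition rate :: "real \<Rightarrow> real" where
  "rate t = t * b t * gap t + t * (norm (v t))\<^sup>2"

text \<open>A null set outside of which the evolution equation holds with genuine derivatives.\<close>

definition singular :: "real set" where
  "singular = (SOME N. negligible N \<and> (\<forall>t\<ge>t0. t \<notin> N \<longrightarrow>
        v differentiable (at t within {t0..}) \<and>
        g differentiable (at t within {t0..}) \<and>
        dot t0 v t + (\<alpha> / t) *\<^sub>R v t + \<beta> t *\<^sub>R dot t0 g t + b t *\<^sub>R g t = 0))"

lemma singular:
  shows "negligible singular"
    and "t0 \<le> t \<Longrightarrow> t \<notin> singular \<Longrightarrow> (v has_vector_derivative dot t0 v t) (at t within {t0..})"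
    and "t0 \<le> t \<Longrightarrow> t \<notin> singular \<Longrightarrow> (g has_vector_derivative dot t0 g t) (at t within {t0..})"
    and "t0 \<le> t \<Longrightarrow> t \<notin> singular \<Longrightarrow> dot t0 v t = - (\<alpha> / t) *\<^sub>R v t - \<beta> t *\<^sub>R dot t0 g t - b t *\<^sub>R g t"
proof -
  let ?P = "\<lambda>t. t \<ge> t0 \<longrightarrow>
        v differentiable (at t within {t0..}) \<and>
        g differentiable (at t within {t0..}) \<and>
        dot t0 v t + (\<alpha> / t) *\<^sub>R v t + \<beta> t *\<^sub>R dot t0 g t + b t *\<^sub>R g t = 0"
  have "AE t in lborel. ?P t" using solution unfolding is_solution_def g_def by blast
  then obtain N where N: "{t. \<not> ?P t} \<subseteq> N" "N \<in> null_sets lborel"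
    by (auto simp: eventually_ae_filter)
  then have "negligible N"
    by (simp add: negligible_iff_null_sets null_sets_completionI)
  with N(1) have "\<exists>N. negligible N \<and> (\<forall>t\<ge>t0. t \<notin> N \<longrightarrow>
        v differentiable (at t within {t0..}) \<and>
        g differentiable (at t within {t0..}) \<and>
        dot t0 v t + (\<alpha> / t) *\<^sub>R v t + \<beta> t *\<^sub>R dot t0 g t + b t *\<^sub>R g t = 0)" by blast
  from someI_ex[OF this, folded singular_def]
  have *: "negligible singular" "\<And>t. t0 \<le> t \<Longrightarrow> t \<notin> singular \<Longrightarrow> v differentiable (at t within {t0..}) \<and>
        g differentiable (at t within {t0..}) \<and>
        dot t0 v t + (\<alpha> / t) *\<^sub>R v t + \<beta> t *\<^sub>R dot t0 g t + b t *\<^sub>R g t = 0" by auto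
  show "negligible singular" by (rule *)
  assume t: "t0 \<le> t" "t \<notin> singular"
  show "(v has_vector_derivative dot t0 v t) (at t within {t0..})"
    "(g has_vector_derivative dot t0 g t) (at t within {t0..})"
    using *(2)[OF t] by (simp_all add: dot_def vector_derivative_works)
  have "dot t0 v t + ((\<alpha> / t) *\<^sub>R v t + \<beta> t *\<^sub>R dot t0 g t + b t *\<^sub>R g t) = 0"
    using *(2)[OF t] by (simp add: add.assoc)
  then have "dot t0 v t = - ((\<alpha> / t) *\<^sub>R v t + \<beta> t *\<^sub>R dot t0 g t + b t *\<^sub>R g t)"
    by (simp only: eq_neg_iff_add_eq_0)
  then show "dot t0 v t = - (\<alpha> / t) *\<^sub>R v t - \<beta> t *\<^sub>R dot t0 g t - b t *\<^sub>R g t" by simp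
qed

lemma g_eq: "t0 \<le> t \<Longrightarrow> g t = yosida (lam t) (x t)"
  unfolding g_def moreau_gradient_along_def by (rule gradient_moreau_envelope[OF lam_pos])

lemma x_derivative: "t0 \<le> t \<Longrightarrow> (x has_vector_derivative v t) (at t within {t0..})"
  using solution by (intro has_vector_derivative_dot) (auto simp: is_solution_def)

lemma strong_lusin_v: "t0 \<le> s \<Longrightarrow> s \<le> T \<Longrightarrow> strong_lusin s T v"
  and strong_lusin_g: "t0 \<le> s \<Longrightarrow> s \<le> T \<Longrightarrow> strong_lusin s T g"
  using solution unfolding is_solution_def g_def locally_absolutely_continuous_def
  by (auto intro: absolutely_continuous_imp_strong_lusin)

lemma strong_lusin_of_derivative:
  assumes "t0 \<le> s" "\<And>t. t0 \<le> t \<Longrightarrow> (F has_vector_derivative F' t) (at t within {t0..})"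
  shows "strong_lusin s T F"
  by (rule differentiable_imp_strong_lusin[where F' = F'],
      rule has_vector_derivative_within_subset[OF assms(2)]) (use assms(1) in auto)

lemma g_continuous:
  assumes "t0 \<le> t"
  shows "(g \<longlongrightarrow> g t) (at t within {t0..})"
proof -
  have "continuous_on {t0..t + 1} g"
    using assms by (intro strong_lusin_imp_continuous_on strong_lusin_g) auto
  then have "(g \<longlongrightarrow> g t) (at t within {t0..t + 1})" using assms by (auto simp: continuous_on_def)
  moreover have "at t within {t0..t + 1} = at t within {t0..}"
    by (rule at_within_nhd[of t "{..<t + 1}"]) auto
  ultimately show ?thesis by simp
qed

lemma gap_derivative:
  assumes "t0 \<le> t"
  shows "(gap has_vector_derivative (g t \<bullet> v t - dot t0 lam t / 2 * (norm (g t))\<^sup>2)) (at t within {t0..})"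
proof -
  have eq: "\<And>s. s \<in> {t0..} \<Longrightarrow> g s = yosida (lam s) (x s)" using g_eq by simp
  have "((\<lambda>s. yosida (lam s) (x s)) \<longlongrightarrow> yosida (lam t) (x t)) (at t within {t0..})"
    using g_continuous[OF assms] unfolding eq[of t, simplified, OF assms]
    by (rule Lim_transform_within[OF _ zero_less_one]) (use eq in auto)
  then have "((\<lambda>s. moreau_envelope (lam s) \<Phi> (x s)) has_vector_derivative
      yosida (lam t) (x t) \<bullet> v t - dot t0 lam t / 2 * (norm (yosida (lam t) (x t)))\<^sup>2) (at t within {t0..})"
    using assms lam_pos
    by (intro moreau_envelope_along_curve x_derivative has_vector_derivative_dot lam_diff) auto
  then show ?thesis
    unfolding gap_def[abs_def] has_vector_derivative_diff_const using g_eq[OF assms] by simp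
qed

lemma gap_bounds:
  assumes "t0 \<le> t"
  shows "lam t / 2 * (norm (g t))\<^sup>2 \<le> gap t" "0 \<le> gap t"
    and "z \<in> argmin \<Phi> \<Longrightarrow> gap t \<le> g t \<bullet> (x t - z)"
    and "z \<in> argmin \<Phi> \<Longrightarrow> lam t * norm (g t) \<le> norm (x t - z)"
    and "fin_val (prox (lam t) \<Phi> (x t)) - minimum \<le> gap t"
    and "0 \<le> fin_val (prox (lam t) \<Phi> (x t)) - minimum"
proof -
  note envelope = envelope_minus_minimum_ge[OF lam_pos[OF assms], of "x t", folded gap_def g_eq[OF assms]]
  show "lam t / 2 * (norm (g t))\<^sup>2 \<le> gap t" "fin_val (prox (lam t) \<Phi> (x t)) - minimum \<le> gap t"
    "0 \<le> fin_val (prox (lam t) \<Phi> (x t)) - minimum" by (rule envelope)+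
  then show "0 \<le> gap t" by linarith
  assume z: "z \<in> argmin \<Phi>"
  have "0 \<le> lam t / 2 * (norm (g t))\<^sup>2" using lam_pos[OF assms] by simp
  then show "gap t \<le> g t \<bullet> (x t - z)"
    using yosida_inner_minimizer[OF lam_pos[OF assms] z, of "x t", folded gap_def g_eq[OF assms]] by linarith
  show "lam t * norm (g t) \<le> norm (x t - z)"
    using yosida_norm_bound[OF lam_pos[OF assms] z, of "x t", folded g_eq[OF assms]] .
qed

lemma v_g'_inner:
  assumes "t0 \<le> t" "t \<notin> singular"
  shows "- (norm (v t) * (dot t0 lam t / lam t) * norm (g t)) \<le> v t \<bullet> dot t0 g t"
proof -
  have "((\<lambda>s. yosida (lam s) (x s)) has_vector_derivative dot t0 g t) (at t within {t0..})"
    using singular(3)[OF assms]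
    by (rule has_vector_derivative_transform[rotated 2]) (use assms g_eq in auto)
  from yosida_derivative_inner[OF _ at_within_half_line_nontrivial[OF assms(1)] _ x_derivative[OF assms(1)]
      has_vector_derivative_dot[OF lam_diff assms(1)] this]
  show ?thesis
    using assms lam_pos dot_nonneg_of_mono[OF lam_mono lam_diff assms(1)] g_eq[OF assms(1)] by simp
qed

text \<open>The integrated form of a differential inequality that holds almost everywhere.\<close>

lemma energy_increment_le:
  fixes E :: "real \<Rightarrow> real"
  assumes sT: "t0 \<le> s" "s \<le> T" and SL: "strong_lusin s T E"
    and der: "\<And>t. t0 \<le> t \<Longrightarrow> t \<notin> singular \<Longrightarrow> (E has_vector_derivative E' t) (at t within {t0..})"
    and le: "\<And>t. t0 \<le> t \<Longrightarrow> t \<notin> singular \<Longrightarrow> E' t \<le> r t" and r: "r integrable_on {s..T}"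
  shows "E T - E s \<le> integral {s..T} r"
proof -
  have "(E' has_integral (E T - E s)) {s..T}"
    by (rule fundamental_theorem_strong_lusin[OF sT(2) SL singular(1)],
        rule has_vector_derivative_within_subset[OF der]) (use sT in auto)
  then have "((\<lambda>t. if t \<in> singular then r t else E' t) has_integral (E T - E s)) {s..T}"
    by (rule has_integral_spike[OF singular(1), rotated]) auto
  moreover have "(r has_integral integral {s..T} r) {s..T}" using r by (simp add: has_integral_integral[symmetric])
  ultimately show ?thesis by (rule has_integral_le) (use le sT in auto)
qed

lemma rate_nonneg: "t0 \<le> t \<Longrightarrow> 0 \<le> rate t"
  unfolding rate_def using t0_pos b_pos[of t] gap_bounds(2)[of t] by simp

lemma continuous_of_derivative:
  assumes "\<And>t. t0 \<le> t \<Longrightarrow> (F has_vector_derivative F' t) (at t within {t0..})"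
  shows "continuous_on {t0..} F"
  using assms by (auto intro!: has_vector_derivative_continuous simp: continuous_on_eq_continuous_within)

lemma rate_integrable:
  assumes "t0 \<le> s" shows "rate integrable_on {s..T}"
proof (rule integrable_continuous_real)
  have "continuous_on {t0..} gap" by (rule continuous_of_derivative[OF gap_derivative])
  moreover have "continuous_on {t0..} v" using solution by (simp add: is_solution_def)
  moreover have "continuous_on {t0..} b" by (rule differentiable_imp_continuous_on[OF b_diff])
  ultimately have "continuous_on {t0..} rate"
    unfolding rate_def[abs_def] by (intro continuous_intros)
  then show "continuous_on {s..T} rate" by (rule continuous_on_subset) (use assms in auto)
qed

lemma slack_integrable:
  shows "t0 \<le> s \<Longrightarrow> slack integrable_on {s..T}"
    and "t0 \<le> T \<Longrightarrow> integral {t0..T} slack \<le> integral {t0..} slack"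
proof -
  let ?s = "\<lambda>t. indicator {t0..} t * slack t"
  let ?i = "\<lambda>t. indicator {t0..} t :: real"
  have cont: "(\<lambda>t. ?i t * f t) \<in> borel_measurable borel" if "f differentiable_on {t0..}" for f :: "real \<Rightarrow> real"
    using borel_measurable_continuous_on_indicator[OF _ differentiable_imp_continuous_on[OF that]] by simp
  note [measurable] = cont[OF \<beta>_diff] cont[OF b_diff] cont[OF lam_diff] dot_borel_measurable[OF lam_diff]
  have "?s t = max 0 ((?i t * dot t0 lam t)\<^sup>2 * t ^ 3 * (?i t * \<beta> t)\<^sup>2 / (?i t * lam t) ^ 4
              - (?i t * dot t0 lam t) * t\<^sup>2 * (?i t * b t) / (2 * (?i t * lam t)\<^sup>2))" for t
    by (auto simp: slack_def indicator_def)
  then have meas: "?s \<in> borel_measurable lborel" by simp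
  have "(\<integral>\<^sup>+ t. ennreal (?s t) \<partial>lborel) = (\<integral>\<^sup>+ t\<in>{t0..}. ennreal (slack t) \<partial>lborel)"
    by (intro nn_integral_cong) (auto simp: indicator_def)
  also have "\<dots> < \<infinity>" using slack_finite by (simp add: slack_def)
  finally have "integrable lborel ?s"
    by (intro integrableI_nonneg meas) (auto simp: slack_def)
  then have "set_integrable lborel {t0..} slack" by (simp add: set_integrable_def)
  then have I: "slack integrable_on {t0..}" by (rule set_borel_integral_eq_integral)
  then have J: "slack integrable_on {s..T}" if "t0 \<le> s" for s T
    by (rule integrable_on_subinterval) (use that in auto)
  show "slack integrable_on {s..T}" if "t0 \<le> s" by (rule J[OF that])
  show "integral {t0..T} slack \<le> integral {t0..} slack" if "t0 \<le> T"
    by (rule integral_subset_le) (use I J in \<open>auto simp: slack_def\<close>)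
qed

lemma w_derivative:
  assumes "t0 \<le> t"
  shows "(w has_vector_derivative dot t0 w t) (at t within {t0..})"
proof (rule has_vector_derivative_dot[OF _ assms])
  show "w differentiable_on {t0..}"
    unfolding differentiable_on_def
  proof
    fix s assume s: "s \<in> {t0..}"
    then have "s \<noteq> 0" using t0_pos by auto
    with s show "w differentiable (at s within {t0..})"
      using b_diff \<beta>'_diff \<beta>_diff unfolding w_fun_def[abs_def] differentiable_on_def
      by (intro derivative_intros) auto
  qed
qed

lemma derivatives_at:
  assumes "t0 \<le> t"
  shows "(\<beta> has_vector_derivative dot t0 \<beta> t) (at t within {t0..})"
    and "((\<lambda>s. s\<^sup>2 * b s) has_vector_derivative dot t0 (\<lambda>s. s\<^sup>2 * b s) t) (at t within {t0..})"
proof -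
  show "(\<beta> has_vector_derivative dot t0 \<beta> t) (at t within {t0..})"
    by (rule has_vector_derivative_dot[OF \<beta>_diff assms])
  show "((\<lambda>s. s\<^sup>2 * b s) has_vector_derivative dot t0 (\<lambda>s. s\<^sup>2 * b s) t) (at t within {t0..})"
  proof (rule has_vector_derivative_dot[OF _ assms])
    show "(\<lambda>s. s\<^sup>2 * b s) differentiable_on {t0..}"
      using b_diff unfolding differentiable_on_def by (auto intro!: derivative_intros)
  qed
qed

text \<open>The growth condition leaves a margin \<open>\<epsilon>\<close>. The anchor is taken \<open>\<epsilon> / 2\<close> below its largest admissible weight
\<open>\<alpha> - 1\<close>, so that one half of the margin remains for the gap and the other half yields the decay in the velocity and the bound on
\<open>x - z\<close>.\<close>

definition anchor_weight :: real where "anchor_weight = \<alpha> - 1 - \<epsilon> / 2"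

text \<open>This is the factor of \<open>- (g \<bullet> v)\<close> in the derivative of half the squared anchored velocity, so that the
two cross terms cancel.\<close>

definition potential_weight :: "real \<Rightarrow> real" where
  "potential_weight t = t\<^sup>2 * w t + \<epsilon> / 2 * (t * \<beta> t)"

definition anchored_velocity :: "'a \<Rightarrow> real \<Rightarrow> 'a" where
  "anchored_velocity z t = anchor_weight *\<^sub>R (x t - z) + t *\<^sub>R (v t + \<beta> t *\<^sub>R g t)"

definition lyapunov :: "'a \<Rightarrow> real \<Rightarrow> real" where
  "lyapunov z t = potential_weight t * gap t + 1 / 2 * (anchored_velocity z t \<bullet> anchored_velocity z t)
     + anchor_weight * (\<epsilon> / 2) / 2 * ((x t - z) \<bullet> (x t - z))"

lemma potential_weight_derivative:
  assumes "t0 \<le> t"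
  shows "(potential_weight has_vector_derivative
      (2 * t * w t + t\<^sup>2 * dot t0 w t + \<epsilon> / 2 * (\<beta> t + t * dot t0 \<beta> t))) (at t within {t0..})"
proof -
  have "((\<lambda>s. s * (s * w s) + \<epsilon> / 2 * (s * \<beta> s)) has_vector_derivative
      (t * (t * dot t0 w t + 1 * w t) + 1 * (t * w t) + \<epsilon> / 2 * (t * dot t0 \<beta> t + 1 * \<beta> t))) (at t within {t0..})"
    by (intro has_vector_derivative_add has_vector_derivative_real_mult[of "\<lambda>s. s" 1]
        has_vector_derivative_mult_right has_vector_derivative_id w_derivative assms derivatives_at)
  then show ?thesis
    by (simp add: potential_weight_def[abs_def] power2_eq_square algebra_simps)
qed

text \<open>The equation eliminates the acceleration together with the derivative of the gradient; what remains are multiples of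
\<open>v\<close> and \<open>g\<close>.\<close>

lemma anchored_velocity_derivative:
  assumes t: "t0 \<le> t" "t \<notin> singular"
  shows "(anchored_velocity z has_vector_derivative (- (\<epsilon> / 2) *\<^sub>R v t - (t * w t) *\<^sub>R g t)) (at t within {t0..})"
proof -
  have "t \<noteq> 0" using t t0_pos by auto
  have "(anchored_velocity z has_vector_derivative
     anchor_weight *\<^sub>R (v t - 0) + (t *\<^sub>R (dot t0 v t + (\<beta> t *\<^sub>R dot t0 g t + dot t0 \<beta> t *\<^sub>R g t))
        + 1 *\<^sub>R (v t + \<beta> t *\<^sub>R g t))) (at t within {t0..})"
    unfolding anchored_velocity_def[abs_def]
    by (intro has_vector_derivative_add has_vector_derivative_diff has_vector_derivative_const
        has_vector_derivative_real_scaleR[of "\<lambda>s. s" 1] has_vector_derivative_real_scaleR[of \<beta>]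
        bounded_linear.has_vector_derivative[OF bounded_linear_scaleR_right]
        has_vector_derivative_id x_derivative t derivatives_at singular)
  moreover have "anchor_weight *\<^sub>R (v t - 0) + (t *\<^sub>R (dot t0 v t + (\<beta> t *\<^sub>R dot t0 g t + dot t0 \<beta> t *\<^sub>R g t))
        + 1 *\<^sub>R (v t + \<beta> t *\<^sub>R g t)) = (anchor_weight + 1 - t * (\<alpha> / t)) *\<^sub>R v t
          + (t * dot t0 \<beta> t + \<beta> t - t * b t) *\<^sub>R g t"
    unfolding singular(4)[OF t] by (simp add: algebra_simps)
  moreover have "anchor_weight + 1 - t * (\<alpha> / t) = - (\<epsilon> / 2)"
    using \<open>t \<noteq> 0\<close> by (simp add: anchor_weight_def)
  moreover have "t * dot t0 \<beta> t + \<beta> t - t * b t = - (t * w t)"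
    using \<open>t \<noteq> 0\<close> by (simp add: w_fun_def algebra_simps)
  ultimately show ?thesis by simp
qed

definition lyapunov_derivative :: "'a \<Rightarrow> real \<Rightarrow> real" where
  "lyapunov_derivative z t =
     (potential_weight t * (g t \<bullet> v t - dot t0 lam t / 2 * (norm (g t))\<^sup>2)
       + (2 * t * w t + t\<^sup>2 * dot t0 w t + \<epsilon> / 2 * (\<beta> t + t * dot t0 \<beta> t)) * gap t)
     + anchored_velocity z t \<bullet> (- (\<epsilon> / 2) *\<^sub>R v t - (t * w t) *\<^sub>R g t)
     + anchor_weight * (\<epsilon> / 2) * ((x t - z) \<bullet> v t)"

lemma lyapunov_has_derivative:
  assumes t: "t0 \<le> t" "t \<notin> singular"
  shows "(lyapunov z has_vector_derivative lyapunov_derivative z t) (at t within {t0..})"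
proof -
  let ?V = "anchored_velocity z" and ?V' = "- (\<epsilon> / 2) *\<^sub>R v t - (t * w t) *\<^sub>R g t"
  have "(lyapunov z has_vector_derivative
     (potential_weight t * (g t \<bullet> v t - dot t0 lam t / 2 * (norm (g t))\<^sup>2)
       + (2 * t * w t + t\<^sup>2 * dot t0 w t + \<epsilon> / 2 * (\<beta> t + t * dot t0 \<beta> t)) * gap t)
     + 1 / 2 * (?V t \<bullet> ?V' + ?V' \<bullet> ?V t)
     + anchor_weight * (\<epsilon> / 2) / 2 * ((x t - z) \<bullet> (v t - 0) + (v t - 0) \<bullet> (x t - z))) (at t within {t0..})"
    unfolding lyapunov_def[abs_def]
    by (intro has_vector_derivative_add has_vector_derivative_diff has_vector_derivative_const
        has_vector_derivative_real_mult[of potential_weight] has_vector_derivative_inner has_vector_derivative_mult_right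
        potential_weight_derivative gap_derivative anchored_velocity_derivative x_derivative t)
  then show ?thesis
  proof (rule has_vector_derivative_eq_rhs)
    have "?V' \<bullet> ?V t = ?V t \<bullet> ?V'" "v t \<bullet> (x t - z) = (x t - z) \<bullet> v t" by (rule inner_commute)+
    then show "(potential_weight t * (g t \<bullet> v t - dot t0 lam t / 2 * (norm (g t))\<^sup>2)
       + (2 * t * w t + t\<^sup>2 * dot t0 w t + \<epsilon> / 2 * (\<beta> t + t * dot t0 \<beta> t)) * gap t)
     + 1 / 2 * (?V t \<bullet> ?V' + ?V' \<bullet> ?V t)
     + anchor_weight * (\<epsilon> / 2) / 2 * ((x t - z) \<bullet> (v t - 0) + (v t - 0) \<bullet> (x t - z)) = lyapunov_derivative z t"
      unfolding lyapunov_derivative_def by simp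
  qed
qed

lemma strong_lusin_lyapunov:
  assumes "t0 \<le> s" "s \<le> T"
  shows "strong_lusin s T (lyapunov z)"
proof -
  note D = strong_lusin_of_derivative[OF assms(1)]
  note B = strong_lusin_bilinear[OF bounded_bilinear_mult] strong_lusin_bilinear[OF bounded_bilinear_scaleR]
    strong_lusin_bilinear[OF bounded_bilinear_inner]
  have const: "strong_lusin s T (\<lambda>t. k)" for k :: "'b::real_normed_vector"
    by (rule D) (rule has_vector_derivative_const)
  have id: "strong_lusin s T (\<lambda>t. t)" by (rule D) (rule has_vector_derivative_id)
  have xz: "strong_lusin s T (\<lambda>t. x t - z)"
    by (rule D[where F' = "\<lambda>t. v t - 0"]) (intro has_vector_derivative_diff has_vector_derivative_const x_derivative)
  have pw: "strong_lusin s T potential_weight" by (rule D[OF potential_weight_derivative])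
  have gp: "strong_lusin s T gap" by (rule D[OF gap_derivative])
  have \<beta>: "strong_lusin s T \<beta>" by (rule D[OF derivatives_at(1)])
  have "strong_lusin s T (anchored_velocity z)"
    unfolding anchored_velocity_def[abs_def]
    by (intro strong_lusin_add B const id xz \<beta> strong_lusin_v strong_lusin_g assms)
  then show ?thesis
    unfolding lyapunov_def[abs_def] by (intro strong_lusin_add B const xz pw gp)
qed

lemma weights_pos:
  shows "0 < anchor_weight" and "t0 \<le> t \<Longrightarrow> 0 < w t" and "t0 \<le> t \<Longrightarrow> 0 \<le> potential_weight t"
proof -
  show "0 < anchor_weight" using \<epsilon> by (simp add: anchor_weight_def)
  show w: "0 < w t" if "t0 \<le> t" using w_pos[OF that] by (simp add: w_fun_def)
  show "0 \<le> potential_weight t" if "t0 \<le> t"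
    using w[OF that] \<beta>_nonneg[OF that] t0_pos that \<epsilon> unfolding potential_weight_def
    by (intro add_nonneg_nonneg mult_nonneg_nonneg) auto
qed

text \<open>All products of \<open>v\<close> with \<open>g\<close> and with \<open>x - z\<close> cancel. The terms in \<open>(norm (g t))\<^sup>2\<close> are nonpositive, because \<open>lam\<close> is
nondecreasing; the product \<open>g \<bullet> (x - z)\<close> is at least the gap by convexity; and the growth condition makes the
resulting factor of the gap negative.\<close>

lemma lyapunov_derivative_le:
  assumes z: "z \<in> argmin \<Phi>" and t: "t0 \<le> t"
  shows "lyapunov_derivative z t \<le> - (\<epsilon> / 2) * rate t"
proof -
  define c where "c = anchor_weight"
  define P where "P = potential_weight t"
  define l where "l = dot t0 lam t"
  have "t > 0" using t t0_pos by simp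
  have P: "P = t\<^sup>2 * w t + \<epsilon> / 2 * (t * \<beta> t)" "0 \<le> P"
    using weights_pos(3)[OF t] by (simp_all add: P_def potential_weight_def)
  have c: "c = \<alpha> - 1 - \<epsilon> / 2" "0 < c" using weights_pos(1) by (simp_all add: c_def anchor_weight_def)
  have l: "0 \<le> l" using dot_nonneg_of_mono[OF lam_mono lam_diff t] by (simp add: l_def)
  have w: "0 < w t" by (rule weights_pos(2)[OF t])
  \<comment> \<open>The definition of \<open>w\<close>: the three terms multiplied by \<open>\<epsilon> / 2\<close> recombine into \<open>t * b t\<close>.\<close>
  have tw: "t * w t + \<beta> t + t * dot t0 \<beta> t = t * b t"
    using \<open>t > 0\<close> by (simp add: w_fun_def algebra_simps)
  have V: "anchored_velocity z t \<bullet> (- (\<epsilon> / 2) *\<^sub>R v t - (t * w t) *\<^sub>R g t)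
      = - (\<epsilon> / 2) * c * ((x t - z) \<bullet> v t) - c * t * w t * (g t \<bullet> (x t - z)) - \<epsilon> / 2 * t * (norm (v t))\<^sup>2
        - t\<^sup>2 * w t * (g t \<bullet> v t) - \<epsilon> / 2 * t * \<beta> t * (g t \<bullet> v t) - t\<^sup>2 * w t * \<beta> t * (norm (g t))\<^sup>2"
  proof -
    have "(c *\<^sub>R X + t *\<^sub>R (v t + \<beta> t *\<^sub>R g t)) \<bullet> (- (\<epsilon> / 2) *\<^sub>R v t - (t * w t) *\<^sub>R g t)
      = - (\<epsilon> / 2) * c * (X \<bullet> v t) - c * t * w t * (g t \<bullet> X) - \<epsilon> / 2 * t * (v t \<bullet> v t)
        - t\<^sup>2 * w t * (g t \<bullet> v t) - \<epsilon> / 2 * t * \<beta> t * (g t \<bullet> v t) - t\<^sup>2 * w t * \<beta> t * (g t \<bullet> g t)" for X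
      by (simp add: inner_diff_right inner_add_left inner_commute[of X "g t"] inner_commute[of "v t" "g t"]
          power2_eq_square algebra_simps)
    then show ?thesis by (simp only: anchored_velocity_def c_def power2_norm_eq_inner)
  qed
  have "lyapunov_derivative z t = (2 * t * w t + t\<^sup>2 * dot t0 w t + \<epsilon> / 2 * (\<beta> t + t * dot t0 \<beta> t)) * gap t
      - P * l / 2 * (norm (g t))\<^sup>2 - c * t * w t * (g t \<bullet> (x t - z)) - \<epsilon> / 2 * t * (norm (v t))\<^sup>2
      - t\<^sup>2 * w t * \<beta> t * (norm (g t))\<^sup>2"
    unfolding lyapunov_derivative_def V P_def[symmetric] l_def[symmetric] c_def[symmetric]
    unfolding P(1) by (simp add: algebra_simps)
  also have "\<dots> \<le> (2 * t * w t + t\<^sup>2 * dot t0 w t + \<epsilon> / 2 * (\<beta> t + t * dot t0 \<beta> t)) * gap t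
      - 0 - c * t * w t * gap t - \<epsilon> / 2 * t * (norm (v t))\<^sup>2 - 0"
    using gap_bounds(3)[OF t z] P(2) l c(2) w \<open>t > 0\<close> \<beta>_nonneg[OF t]
    by (intro diff_mono mult_left_mono order_refl) auto
  also have "\<dots> = (t * (- ((\<alpha> - 3) * w t - t * dot t0 w t))
      + \<epsilon> / 2 * (t * w t + \<beta> t + t * dot t0 \<beta> t)) * gap t - \<epsilon> / 2 * t * (norm (v t))\<^sup>2"
    using \<open>t > 0\<close> by (simp add: c(1) power2_eq_square algebra_simps)
  also have "\<dots> \<le> (t * (- (\<epsilon> * b t)) + \<epsilon> / 2 * (t * b t)) * gap t - \<epsilon> / 2 * t * (norm (v t))\<^sup>2"
    unfolding tw using growth[OF t] gap_bounds(2)[OF t] \<open>t > 0\<close> b_pos[OF t]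
    by (intro diff_mono mult_right_mono add_mono mult_left_mono) auto
  also have "\<dots> = - (\<epsilon> / 2) * rate t"
    using \<open>t > 0\<close> by (simp add: rate_def algebra_simps)
  finally show ?thesis .
qed

lemma lyapunov_bounds:
  assumes z: "z \<in> argmin \<Phi>" and T: "t0 \<le> T"
  shows "\<epsilon> / 2 * integral {t0..T} rate \<le> lyapunov z t0"
    and "anchor_weight * (\<epsilon> / 2) / 2 * (norm (x T - z))\<^sup>2 \<le> lyapunov z t0"
proof -
  have int: "(\<lambda>t. - (\<epsilon> / 2) * rate t) integrable_on {t0..T}"
    by (intro integrable_on_mult_right rate_integrable order_refl)
  have "lyapunov z T - lyapunov z t0 \<le> integral {t0..T} (\<lambda>t. - (\<epsilon> / 2) * rate t)"
    by (rule energy_increment_le[OF order_refl T strong_lusin_lyapunov lyapunov_has_derivative lyapunov_derivative_le])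
      (use T z int in auto)
  then have *: "lyapunov z T + \<epsilon> / 2 * integral {t0..T} rate \<le> lyapunov z t0" by simp
  have I: "0 \<le> integral {t0..T} rate"
    by (rule integral_nonneg[OF rate_integrable]) (use rate_nonneg in auto)
  have pos: "0 \<le> potential_weight T * gap T" "0 \<le> anchor_weight * (\<epsilon> / 2) / 2 * (norm (x T - z))\<^sup>2"
    using weights_pos(1) weights_pos(3)[OF T] gap_bounds(2)[OF T] \<epsilon> by auto
  have N: "0 \<le> 1 / 2 * (norm (anchored_velocity z T))\<^sup>2" by simp
  have E: "lyapunov z T = potential_weight T * gap T + 1 / 2 * (norm (anchored_velocity z T))\<^sup>2
      + anchor_weight * (\<epsilon> / 2) / 2 * (norm (x T - z))\<^sup>2"
    by (simp add: lyapunov_def power2_norm_eq_inner)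
  show "\<epsilon> / 2 * integral {t0..T} rate \<le> lyapunov z t0"
    using * pos E N by linarith
  have "0 \<le> \<epsilon> / 2 * integral {t0..T} rate" using I \<epsilon> by simp
  then show "anchor_weight * (\<epsilon> / 2) / 2 * (norm (x T - z))\<^sup>2 \<le> lyapunov z t0"
    using * pos(1) E N by linarith
qed

definition total_energy :: "real \<Rightarrow> real" where
  "total_energy t = t\<^sup>2 * b t * gap t + 1 / 2 * (t *\<^sub>R v t \<bullet> t *\<^sub>R v t)"

definition total_energy_derivative :: "real \<Rightarrow> real" where
  "total_energy_derivative t =
     t\<^sup>2 * b t * (g t \<bullet> v t - dot t0 lam t / 2 * (norm (g t))\<^sup>2) + dot t0 (\<lambda>s. s\<^sup>2 * b s) t * gap t
     + t *\<^sub>R v t \<bullet> (t *\<^sub>R dot t0 v t + v t)"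

lemma total_energy_has_derivative:
  assumes t: "t0 \<le> t" "t \<notin> singular"
  shows "(total_energy has_vector_derivative total_energy_derivative t) (at t within {t0..})"
proof -
  let ?V' = "t *\<^sub>R dot t0 v t + 1 *\<^sub>R v t"
  have "(total_energy has_vector_derivative
     (t\<^sup>2 * b t * (g t \<bullet> v t - dot t0 lam t / 2 * (norm (g t))\<^sup>2) + dot t0 (\<lambda>s. s\<^sup>2 * b s) t * gap t)
     + 1 / 2 * (t *\<^sub>R v t \<bullet> ?V' + ?V' \<bullet> t *\<^sub>R v t)) (at t within {t0..})"
    unfolding total_energy_def[abs_def]
    by (intro has_vector_derivative_add has_vector_derivative_real_mult[of "\<lambda>s. s\<^sup>2 * b s"]
        has_vector_derivative_inner has_vector_derivative_mult_right has_vector_derivative_real_scaleR[of "\<lambda>s. s" 1]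
        has_vector_derivative_id gap_derivative derivatives_at singular t)
  then show ?thesis
  proof (rule has_vector_derivative_eq_rhs)
    show "(t\<^sup>2 * b t * (g t \<bullet> v t - dot t0 lam t / 2 * (norm (g t))\<^sup>2) + dot t0 (\<lambda>s. s\<^sup>2 * b s) t * gap t)
     + 1 / 2 * (t *\<^sub>R v t \<bullet> ?V' + ?V' \<bullet> t *\<^sub>R v t) = total_energy_derivative t"
      unfolding total_energy_derivative_def inner_commute[of ?V' "t *\<^sub>R v t"] by simp
  qed
qed

lemma strong_lusin_total_energy:
  assumes "t0 \<le> s" "s \<le> T"
  shows "strong_lusin s T total_energy"
proof -
  note D = strong_lusin_of_derivative[OF assms(1)]
  note B = strong_lusin_bilinear[OF bounded_bilinear_mult] strong_lusin_bilinear[OF bounded_bilinear_scaleR]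
    strong_lusin_bilinear[OF bounded_bilinear_inner]
  have const: "strong_lusin s T (\<lambda>t. k)" for k :: real by (rule D) (rule has_vector_derivative_const)
  have id: "strong_lusin s T (\<lambda>t. t)" by (rule D) (rule has_vector_derivative_id)
  have pw: "strong_lusin s T (\<lambda>t. t\<^sup>2 * b t)" by (rule D[OF derivatives_at(2)])
  have gp: "strong_lusin s T gap" by (rule D[OF gap_derivative])
  have sv: "strong_lusin s T (\<lambda>t. t *\<^sub>R v t)" by (intro B id strong_lusin_v assms)
  show ?thesis
    unfolding total_energy_def[abs_def] by (intro strong_lusin_add B const pw gp sv)
qed

text \<open>The cross terms \<open>g \<bullet> v\<close> of potential and kinetic energy cancel. The remaining product of \<open>v\<close> with the derivative of the gradient is
bounded below by monotonicity. Young's inequality with the weight \<open>t\<close> splits it into a part dominated by the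
dissipation rate and a part that, with the bound \<open>M\<close> on \<open>lam t * norm (g t)\<close>, is dominated by the integrable slack.\<close>

lemma total_energy_derivative_le:
  assumes t: "t0 \<le> t" "t \<notin> singular" and M: "lam t * norm (g t) \<le> M"
  shows "total_energy_derivative t \<le> (C + 1) * rate t + M\<^sup>2 * slack t"
proof -
  define l where "l = dot t0 lam t"
  have pos: "t > 0" "0 \<le> \<beta> t" "0 < b t" "0 < lam t" "0 \<le> gap t"
    using t t0_pos \<beta>_nonneg b_pos lam_pos gap_bounds(2) by auto
  have "total_energy_derivative t = dot t0 (\<lambda>s. s\<^sup>2 * b s) t * gap t + (1 - \<alpha>) * (t * (norm (v t))\<^sup>2)
      - t\<^sup>2 * \<beta> t * (v t \<bullet> dot t0 g t) - t\<^sup>2 * b t * l / 2 * (norm (g t))\<^sup>2"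
  proof -
    have "t *\<^sub>R v t \<bullet> (t *\<^sub>R dot t0 v t + v t) = (1 - \<alpha>) * (t * (norm (v t))\<^sup>2)
      - t\<^sup>2 * \<beta> t * (v t \<bullet> dot t0 g t) - t\<^sup>2 * b t * (g t \<bullet> v t)"
      unfolding singular(4)[OF t] power2_norm_eq_inner using pos(1)
      by (simp add: inner_diff_right inner_add_right inner_commute[of "v t" "g t"] power2_eq_square algebra_simps)
    then show ?thesis
      unfolding total_energy_derivative_def l_def by (simp add: algebra_simps)
  qed
  also have "\<dots> \<le> (C * t * b t) * gap t + 0 * (t * (norm (v t))\<^sup>2)
      + (t * (norm (v t))\<^sup>2 + t ^ 3 * (\<beta> t)\<^sup>2 * l\<^sup>2 / (lam t)\<^sup>2 * (norm (g t))\<^sup>2) - t\<^sup>2 * b t * l / 2 * (norm (g t))\<^sup>2"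
  proof -
    \<comment> \<open>Scaled such that \<open>t * y\<^sup>2\<close> is the first term of the slack up to the factor \<open>(lam t * norm (g t))\<^sup>2\<close>.\<close>
    define y where "y = t * \<beta> t * (l / lam t) * norm (g t)"
    have "t\<^sup>2 * \<beta> t * - (v t \<bullet> dot t0 g t) \<le> t\<^sup>2 * \<beta> t * (norm (v t) * (l / lam t) * norm (g t))"
      using v_g'_inner[OF t] pos(2) by (intro mult_left_mono) (auto simp: l_def)
    also have "\<dots> = t * (norm (v t) * y)" by (simp add: y_def power2_eq_square)
    also have "\<dots> \<le> t * ((norm (v t))\<^sup>2 + y\<^sup>2)"
    proof (rule mult_left_mono)
      have "0 \<le> (norm (v t) - y)\<^sup>2" "0 \<le> (norm (v t))\<^sup>2 + y\<^sup>2" by simp_all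
      then show "norm (v t) * y \<le> (norm (v t))\<^sup>2 + y\<^sup>2"
        unfolding power2_diff mult.assoc by linarith
    qed (use pos in simp)
    also have "\<dots> = t * (norm (v t))\<^sup>2 + t ^ 3 * (\<beta> t)\<^sup>2 * l\<^sup>2 / (lam t)\<^sup>2 * (norm (g t))\<^sup>2"
      by (simp add: y_def power2_eq_square power3_eq_cube algebra_simps)
    finally have cross: "- (t\<^sup>2 * \<beta> t * (v t \<bullet> dot t0 g t))
        \<le> t * (norm (v t))\<^sup>2 + t ^ 3 * (\<beta> t)\<^sup>2 * l\<^sup>2 / (lam t)\<^sup>2 * (norm (g t))\<^sup>2" by simp
    have "dot t0 (\<lambda>s. s\<^sup>2 * b s) t * gap t \<le> (C * t * b t) * gap t"
      using b_growth[OF t(1)] pos(5) by (rule mult_right_mono)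
    moreover have "(1 - \<alpha>) * (t * (norm (v t))\<^sup>2) \<le> 0 * (t * (norm (v t))\<^sup>2)"
      using \<alpha>_gt_1 pos(1) by (intro mult_right_mono) auto
    ultimately show ?thesis using cross by linarith
  qed
  also have "\<dots> = C * (t * b t * gap t) + t * (norm (v t))\<^sup>2
      + (l\<^sup>2 * t ^ 3 * (\<beta> t)\<^sup>2 / (lam t) ^ 4 - l * t\<^sup>2 * b t / (2 * (lam t)\<^sup>2)) * (lam t * norm (g t))\<^sup>2"
    using pos(4) by (simp add: field_simps power2_eq_square power4_eq_xxxx)
  also have "\<dots> \<le> (C + 1) * rate t + M\<^sup>2 * slack t"
  proof (rule add_mono)
    have "C * (t * b t * gap t) \<le> (C + 1) * (t * b t * gap t)"
      by (rule mult_right_mono) (use pos in auto)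
    moreover have "1 * (t * (norm (v t))\<^sup>2) \<le> (C + 1) * (t * (norm (v t))\<^sup>2)"
      by (rule mult_right_mono) (use C_pos pos in auto)
    ultimately show "C * (t * b t * gap t) + t * (norm (v t))\<^sup>2 \<le> (C + 1) * rate t"
      unfolding rate_def by (simp add: distrib_left)
    have "(l\<^sup>2 * t ^ 3 * (\<beta> t)\<^sup>2 / (lam t) ^ 4 - l * t\<^sup>2 * b t / (2 * (lam t)\<^sup>2)) * (lam t * norm (g t))\<^sup>2
        \<le> slack t * (lam t * norm (g t))\<^sup>2"
      unfolding slack_def l_def by (intro mult_right_mono) auto
    also have "\<dots> \<le> slack t * M\<^sup>2"
      using M pos(4) by (intro mult_left_mono power_mono) (auto simp: slack_def)
    finally show "(l\<^sup>2 * t ^ 3 * (\<beta> t)\<^sup>2 / (lam t) ^ 4 - l * t\<^sup>2 * b t / (2 * (lam t)\<^sup>2)) * (lam t * norm (g t))\<^sup>2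
        \<le> M\<^sup>2 * slack t" by (simp add: mult.commute)
  qed
  finally show ?thesis .
qed

lemma total_energy_eq: "total_energy t = t\<^sup>2 * b t * gap t + 1 / 2 * (t * norm (v t))\<^sup>2"
  by (simp add: total_energy_def power_mult_distrib power2_norm_eq_inner) (simp add: power2_eq_square)

lemma total_energy_tendsto_zero: "(total_energy \<longlongrightarrow> 0) at_top"
proof -
  obtain z where z: "z \<in> argmin \<Phi>" using argmin_nonempty by blast
  define a where "a = anchor_weight * (\<epsilon> / 2) / 2"
  have a: "0 < a" using weights_pos(1) \<epsilon> by (simp add: a_def)
  \<comment> \<open>The Lyapunov function is nonincreasing and dominates \<open>a\<close> times the squared distance to \<open>z\<close>.\<close>
  define M where "M = sqrt (lyapunov z t0 / a)"
  have M: "lam t * norm (g t) \<le> M" if "t0 \<le> t" for t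
  proof -
    have "(norm (x t - z))\<^sup>2 \<le> lyapunov z t0 / a"
      using lyapunov_bounds(2)[OF z that] a by (simp add: a_def pos_le_divide_eq mult.commute)
    then have "norm (x t - z) \<le> M" unfolding M_def by (rule real_le_rsqrt)
    then show ?thesis using gap_bounds(4)[OF that z] by linarith
  qed
  have pos: "t > 0" "0 < b t" "0 \<le> gap t" if "t0 \<le> t" for t
    using that t0_pos b_pos gap_bounds(2) by auto
  show ?thesis
  proof (rule dissipation_tendsto_zero[where q = rate and K = "C + 1" and \<theta> = "\<lambda>t. M\<^sup>2 * slack t"
        and B = "lyapunov z t0 / (\<epsilon> / 2)" and B' = "M\<^sup>2 * integral {t0..} slack"])
    show "t0 > 0" "0 \<le> C + 1" using t0_pos C_pos by auto
    fix t assume t: "t0 \<le> t"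
    show "0 \<le> total_energy t" using pos[OF t] by (simp add: total_energy_eq)
    show "0 \<le> rate t" by (rule rate_nonneg[OF t])
    show "0 \<le> M\<^sup>2 * slack t" by (simp add: slack_def)
    have "0 \<le> (t * norm (v t))\<^sup>2" by simp
    then show "total_energy t \<le> t * rate t"
      by (simp add: total_energy_eq rate_def power2_eq_square algebra_simps)
  next
    fix T assume T: "t0 \<le> T"
    show "integral {t0..T} rate \<le> lyapunov z t0 / (\<epsilon> / 2)"
      using lyapunov_bounds(1)[OF z T] \<epsilon>(1) by (simp add: pos_le_divide_eq mult.commute)
    show "integral {t0..T} (\<lambda>t. M\<^sup>2 * slack t) \<le> M\<^sup>2 * integral {t0..} slack"
      using slack_integrable(2)[OF T] by (simp add: mult_left_mono)
  next
    fix s T assume s: "t0 \<le> s"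
    show r: "rate integrable_on {s..T}" by (rule rate_integrable[OF s])
    show th: "(\<lambda>t. M\<^sup>2 * slack t) integrable_on {s..T}"
      by (intro integrable_on_mult_right slack_integrable s)
    assume T: "s \<le> T"
    show "total_energy T - total_energy s \<le> integral {s..T} (\<lambda>t. (C + 1) * rate t + M\<^sup>2 * slack t)"
      by (rule energy_increment_le[OF s T strong_lusin_total_energy[OF s T]
            total_energy_has_derivative total_energy_derivative_le[OF _ _ M]])
        (use r th in \<open>auto intro!: integrable_add integrable_on_mult_right\<close>)
  qed
qed

lemma gap_rate: "((\<lambda>t. t\<^sup>2 * b t * gap t) \<longlongrightarrow> 0) at_top"
proof (rule tendsto_sandwich[OF _ _ tendsto_const total_energy_tendsto_zero])
  show "eventually (\<lambda>t. 0 \<le> t\<^sup>2 * b t * gap t) at_top"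
    using eventually_ge_at_top[of t0] by eventually_elim (simp add: less_imp_le b_pos gap_bounds(2))
  show "eventually (\<lambda>t. t\<^sup>2 * b t * gap t \<le> total_energy t) at_top"
    by (simp add: total_energy_eq)
qed

lemma velocity_rate: "((\<lambda>t. t * norm (v t)) \<longlongrightarrow> 0) at_top"
proof -
  have "((\<lambda>t. sqrt (2 * (total_energy t - t\<^sup>2 * b t * gap t))) \<longlongrightarrow> sqrt (2 * (0 - 0))) at_top"
    by (intro tendsto_intros total_energy_tendsto_zero gap_rate)
  moreover have "eventually (\<lambda>t. sqrt (2 * (total_energy t - t\<^sup>2 * b t * gap t)) = t * norm (v t)) at_top"
    using eventually_ge_at_top[of 0] by eventually_elim (simp add: total_energy_eq)
  ultimately have "((\<lambda>t. t * norm (v t)) \<longlongrightarrow> sqrt (2 * (0 - 0))) at_top"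
    by (rule Lim_transform_eventually)
  then show ?thesis by simp
qed

lemma gradient_rate: "((\<lambda>t. t * sqrt (b t * lam t) * norm (g t)) \<longlongrightarrow> 0) at_top"
proof (rule tendsto_sandwich[OF _ _ tendsto_const])
  show "eventually (\<lambda>t. 0 \<le> t * sqrt (b t * lam t) * norm (g t)) at_top"
    using eventually_ge_at_top[of t0]
    by eventually_elim (use t0_pos b_pos lam_pos in \<open>simp add: less_imp_le\<close>)
  show "eventually (\<lambda>t. t * sqrt (b t * lam t) * norm (g t) \<le> sqrt (2 * (t\<^sup>2 * b t * gap t))) at_top"
    using eventually_ge_at_top[of t0]
  proof eventually_elim
    case (elim t)
    have pos: "0 < b t" "0 < lam t" using elim b_pos lam_pos by auto
    have "(t * sqrt (b t * lam t) * norm (g t))\<^sup>2 = 2 * (t\<^sup>2 * b t * (lam t / 2 * (norm (g t))\<^sup>2))"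
      using pos by (simp add: power_mult_distrib)
    also have "\<dots> \<le> 2 * (t\<^sup>2 * b t * gap t)"
      using gap_bounds(1)[OF elim] pos by (intro mult_left_mono) auto
    finally show ?case by (rule real_le_rsqrt)
  qed
  have "((\<lambda>t. sqrt (2 * (t\<^sup>2 * b t * gap t))) \<longlongrightarrow> sqrt (2 * 0)) at_top"
    by (intro tendsto_intros gap_rate)
  then show "((\<lambda>t. sqrt (2 * (t\<^sup>2 * b t * gap t))) \<longlongrightarrow> 0) at_top" by simp
qed

lemma prox_value_rate: "((\<lambda>t. t\<^sup>2 * b t * (fin_val (prox (lam t) \<Phi> (x t)) - minimum)) \<longlongrightarrow> 0) at_top"
proof (rule tendsto_sandwich[OF _ _ tendsto_const gap_rate])
  show "eventually (\<lambda>t. 0 \<le> t\<^sup>2 * b t * (fin_val (prox (lam t) \<Phi> (x t)) - minimum)) at_top"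
    using eventually_ge_at_top[of t0]
    by eventually_elim (intro mult_nonneg_nonneg gap_bounds(6), auto intro: less_imp_le b_pos)
  show "eventually (\<lambda>t. t\<^sup>2 * b t * (fin_val (prox (lam t) \<Phi> (x t)) - minimum) \<le> t\<^sup>2 * b t * gap t) at_top"
    using eventually_ge_at_top[of t0]
    by eventually_elim (intro mult_left_mono gap_bounds(5), auto intro!: mult_nonneg_nonneg less_imp_le[OF b_pos])
qed

lemma prox_distance: "t0 \<le> t \<Longrightarrow> norm (prox (lam t) \<Phi> (x t) - x t) = lam t * norm (g t)"
  using lam_pos[of t] by (simp add: prox_yosida g_eq)

end

section \<open>Convergence rates\<close>

lemma smallo_of_tendsto_mult:
  fixes f r :: "real \<Rightarrow> real"
  assumes "((\<lambda>t. r t * f t) \<longlongrightarrow> 0) at_top" and "eventually (\<lambda>t. r t \<noteq> 0) at_top"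
  shows "f \<in> o[at_top](\<lambda>t. 1 / r t)"
proof (rule smalloI_tendsto)
  show "((\<lambda>t. f t / (1 / r t)) \<longlongrightarrow> 0) at_top" using assms(1) by (simp add: mult.commute)
  show "eventually (\<lambda>t. 1 / r t \<noteq> 0) at_top" using assms(2) by eventually_elim simp
qed

theorem theorem4:
  fixes \<Phi> :: "'a::{real_inner, complete_space} \<Rightarrow> ereal"
    and \<alpha> t0 :: real
    and \<beta> b lam :: "real \<Rightarrow> real"
    and x :: "real \<Rightarrow> 'a"
  assumes "proper_fun \<Phi>" and "convex_fun \<Phi>" and "lower_semicontinuous \<Phi>"
    and "argmin \<Phi> \<noteq> {}"
    and "t0 > 0"
    and "\<forall>t\<ge>t0. \<beta> t \<ge> 0" and "\<forall>t\<ge>t0. b t > 0" and "\<forall>t\<ge>t0. lam t > 0"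
    and "b differentiable_on {t0..}" and "lam differentiable_on {t0..}"
    and "\<beta> differentiable_on {t0..}" and "dot t0 \<beta> differentiable_on {t0..}"
    and "\<alpha> > 1"
    and "\<exists>\<epsilon>\<in>{0<..<\<alpha> - 1}. \<forall>t\<ge>t0.
           (\<alpha> - 3) * w_fun t0 \<beta> b t - t * dot t0 (w_fun t0 \<beta> b) t \<ge> \<epsilon> * b t"
    and "mono_on {t0..} lam" and "mono_on {t0..} \<beta>"
    and "\<forall>t\<ge>t0. b t > dot t0 \<beta> t + \<beta> t / t"
    and "(\<integral>\<^sup>+ t\<in>{t0..}. ennreal (max 0
            ((dot t0 lam t)\<^sup>2 * t ^ 3 * (\<beta> t)\<^sup>2 / (lam t) ^ 4
              - dot t0 lam t * t\<^sup>2 * b t / (2 * (lam t)\<^sup>2))) \<partial>lborel) < \<infinity>"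
    and "\<exists>C>0. \<forall>t\<ge>t0. dot t0 (\<lambda>s. s\<^sup>2 * b s) t \<le> C * t * b t"
    and "is_solution \<Phi> \<alpha> t0 \<beta> b lam x"
  shows "(\<lambda>t. moreau_envelope (lam t) \<Phi> (x t) - real_of_ereal (min_value \<Phi>))
           \<in> o[at_top](\<lambda>t. 1 / (t\<^sup>2 * b t))
     \<and> (\<lambda>t. norm (dot t0 x t)) \<in> o[at_top](\<lambda>t. 1 / t)
     \<and> (\<lambda>t. norm (gradient (moreau_envelope (lam t) \<Phi>) (x t)))
           \<in> o[at_top](\<lambda>t. 1 / (t * sqrt (b t * lam t)))
     \<and> (\<lambda>t. real_of_ereal (\<Phi> (prox (lam t) \<Phi> (x t)) - min_value \<Phi>))
           \<in> o[at_top](\<lambda>t. 1 / (t\<^sup>2 * b t))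
     \<and> (\<lambda>t. norm (prox (lam t) \<Phi> (x t) - x t))
           \<in> o[at_top](\<lambda>t. sqrt (lam t) / (t * sqrt (b t)))"
proof -
  obtain \<epsilon> where \<epsilon>: "\<epsilon> \<in> {0<..<\<alpha> - 1}"
    "\<forall>t\<ge>t0. (\<alpha> - 3) * w_fun t0 \<beta> b t - t * dot t0 (w_fun t0 \<beta> b) t \<ge> \<epsilon> * b t"
    using assms(14) by blast
  obtain C where C: "C > 0" "\<forall>t\<ge>t0. dot t0 (\<lambda>s. s\<^sup>2 * b s) t \<le> C * t * b t"
    using assms(19) by blast
  interpret inertial_solution \<Phi> \<alpha> t0 \<epsilon> C \<beta> b lam x
    by unfold_locales (use assms \<epsilon> C in auto)
  have large: "eventually (\<lambda>t. t0 \<le> t) at_top" by (rule eventually_ge_at_top)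
  have pos: "0 < t" "0 < b t" "0 < lam t" if "t0 \<le> t" for t
    using that t0_pos b_pos lam_pos by auto
  have 1: "gap \<in> o[at_top](\<lambda>t. 1 / (t\<^sup>2 * b t))"
    by (rule smallo_of_tendsto_mult[OF gap_rate]) (use large in eventually_elim, use pos in force)
  have 2: "(\<lambda>t. norm (v t)) \<in> o[at_top](\<lambda>t. 1 / t)"
    by (rule smallo_of_tendsto_mult[OF velocity_rate]) (use eventually_gt_at_top[of 0] in eventually_elim, simp)
  have nz: "eventually (\<lambda>t. t * sqrt (b t * lam t) \<noteq> 0) at_top"
    using large by eventually_elim (use pos in force)
  have 3: "(\<lambda>t. norm (g t)) \<in> o[at_top](\<lambda>t. 1 / (t * sqrt (b t * lam t)))"
    by (rule smallo_of_tendsto_mult[OF gradient_rate nz])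
  have "(\<lambda>t. fin_val (prox (lam t) \<Phi> (x t)) - minimum) \<in> o[at_top](\<lambda>t. 1 / (t\<^sup>2 * b t))"
    by (rule smallo_of_tendsto_mult[OF prox_value_rate]) (use large in eventually_elim, use pos in force)
  moreover have "eventually (\<lambda>t. fin_val (prox (lam t) \<Phi> (x t)) - minimum
      = real_of_ereal (\<Phi> (prox (lam t) \<Phi> (x t)) - min_value \<Phi>)) at_top"
    using large by eventually_elim (simp add: prox_finite_minimal(1)[OF lam_pos] min_value_eq)
  ultimately have 4: "(\<lambda>t. real_of_ereal (\<Phi> (prox (lam t) \<Phi> (x t)) - min_value \<Phi>))
      \<in> o[at_top](\<lambda>t. 1 / (t\<^sup>2 * b t))"
    by (simp add: landau_o.small.in_cong)
  have "(\<lambda>t. lam t * norm (g t)) \<in> o[at_top](\<lambda>t. lam t * (1 / (t * sqrt (b t * lam t))))"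
    using 3 by (intro landau_o.small.mult_left)
  moreover have "eventually (\<lambda>t. lam t * (1 / (t * sqrt (b t * lam t))) = sqrt (lam t) / (t * sqrt (b t))) at_top"
    using large
  proof eventually_elim
    case (elim t)
    define r where "r = sqrt (lam t)"
    have r: "0 < r" "lam t * (1 / (t * sqrt (b t * lam t))) = r * r / (t * (sqrt (b t) * r))"
      using pos[OF elim] by (simp_all add: r_def real_sqrt_mult)
    show ?case unfolding r(2) r_def[symmetric] using r(1) by simp
  qed
  moreover have "eventually (\<lambda>t. lam t * norm (g t) = norm (prox (lam t) \<Phi> (x t) - x t)) at_top"
    using large by eventually_elim (simp add: prox_distance)
  ultimately have 5: "(\<lambda>t. norm (prox (lam t) \<Phi> (x t) - x t)) \<in> o[at_top](\<lambda>t. sqrt (lam t) / (t * sqrt (b t)))"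
    by (simp add: landau_o.small.in_cong landau_o.small.cong)
  show ?thesis
    using 1 2 3 4 5
    unfolding gap_def[abs_def] minimum_def g_def moreau_gradient_along_def[abs_def] by (intro conjI)
qed

end
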